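(* For every integer $d>1$ there exists $p(d)>1$ such that for every $p$ with $1<p<p(d)$ the projection $\mathrm{P}^p_{\mathbf{R}^d}$ fails to be nonexpansive with respect to the $p$-Wasserstein distance, i.e. there exist $\mu,\nu\in\mathcal{P}_p(\mathbf{R}^d)$ with $$W_p\big(\mathrm{P}^p_{\mathbf{R}^d}[\mu],\mathrm{P}^p_{\mathbf{R}^d}[\nu]\big)>W_p(\mu,\nu).$$ In fact, one can take $p(d)=1+\frac{1}{O(d^2\log d)}$: there is an absolute constant $C>0$ such that for every integer $d>1$ and every $p$ with $1<p<1+\frac{1}{C\,d^2\log d}$ there exist $\mu,\nu\in\mathcal{P}_p(\mathbf{R}^d)$ with $W_p\big(\mathrm{P}^p_{\mathbf{R}^d}[\mu],\mathrm{P}^p_{\mathbf{R}^d}[\nu]\big)>W_p(\mu,\nu)$.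
   Context: $\mathcal{P}_p(\mathbf{R}^d)$ is the set of Borel probability measures on $\mathbf{R}^d$ with finite $p$-th moment and $W_p$ is the $p$-Wasserstein distance for the cost $|x-y|^p$ with the Euclidean norm. Let $\mathcal{K}_p(\mathbf{R}^d)$ be the set of $\rho\in\mathcal{P}_p(\mathbf{R}^d)$ that are absolutely continuous with respect to Lebesgue measure with density satisfying $0\le\rho\le1$ a.e. For $p>1$, $\mathrm{P}^p_{\mathbf{R}^d}[\mu]$ denotes the metric projection of $\mu\in\mathcal{P}_p(\mathbf{R}^d)$ onto $\mathcal{K}_p(\mathbf{R}^d)$, i.e. the minimizer of $\rho\mapsto W_p^p(\rho,\mu)$ over $\rho\in\mathcal{K}_p(\mathbf{R}^d)$, which is known to exist and be unique. *)

theory Defs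
  imports "HOL-Probability.Probability"
begin

text \<open>
  The dimension has to be quantified inside the formula (one absolute constant serves all
  dimensions), so \<open>\<real>\<^sup>d\<close> cannot be a type. Its points are the functions
  \<open>nat \<Rightarrow> real\<close> that are \<open>undefined\<close> outside \<open>{..<d}\<close>, the space of the product measure below.
\<close>

abbreviation borel_Rd :: "nat \<Rightarrow> (nat \<Rightarrow> real) measure" where
  "borel_Rd d \<equiv> Pi\<^sub>M {..<d} (\<lambda>_. borel)"

abbreviation lborel_Rd :: "nat \<Rightarrow> (nat \<Rightarrow> real) measure" where
  "lborel_Rd d \<equiv> Pi\<^sub>M {..<d} (\<lambda>_. lborel)"

definition norm_Rd :: "nat \<Rightarrow> (nat \<Rightarrow> real) \<Rightarrow> real" where
  "norm_Rd d x = L2_set x {..<d}"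

definition dist_Rd :: "nat \<Rightarrow> (nat \<Rightarrow> real) \<Rightarrow> (nat \<Rightarrow> real) \<Rightarrow> real" where
  "dist_Rd d x y = L2_set (\<lambda>i. x i - y i) {..<d}"

definition P_space :: "nat \<Rightarrow> real \<Rightarrow> (nat \<Rightarrow> real) measure set" where
  "P_space d p = {\<mu>. sets \<mu> = sets (borel_Rd d) \<and> prob_space \<mu> \<and>
     (\<integral>\<^sup>+x. ennreal (norm_Rd d x powr p) \<partial>\<mu>) < \<infinity>}"

definition K_space :: "nat \<Rightarrow> real \<Rightarrow> (nat \<Rightarrow> real) measure set" where
  "K_space d p = {\<rho> \<in> P_space d p. \<exists>f \<in> borel_measurable (lborel_Rd d).
     (AE x in lborel_Rd d. 0 \<le> f x \<and> f x \<le> (1::real)) \<and>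
     \<rho> = density (lborel_Rd d) (\<lambda>x. ennreal (f x))}"

definition couplings ::
  "nat \<Rightarrow> (nat \<Rightarrow> real) measure \<Rightarrow> (nat \<Rightarrow> real) measure
     \<Rightarrow> ((nat \<Rightarrow> real) \<times> (nat \<Rightarrow> real)) measure set" where
  "couplings d \<mu> \<nu> = {\<gamma>. sets \<gamma> = sets (borel_Rd d \<Otimes>\<^sub>M borel_Rd d) \<and>
     distr \<gamma> (borel_Rd d) fst = \<mu> \<and> distr \<gamma> (borel_Rd d) snd = \<nu>}"

text \<open>The \<open>p\<close>-th power of the Wasserstein distance; finite on \<^const>\<open>P_space\<close>.\<close>

definition transport_cost ::
  "nat \<Rightarrow> real \<Rightarrow> (nat \<Rightarrow> real) measure \<Rightarrow> (nat \<Rightarrow> real) measure \<Rightarrow> ennreal" where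
  "transport_cost d p \<mu> \<nu> =
     (INF \<gamma> \<in> couplings d \<mu> \<nu>. \<integral>\<^sup>+z. ennreal (dist_Rd d (fst z) (snd z) powr p) \<partial>\<gamma>)"

definition wasserstein ::
  "nat \<Rightarrow> real \<Rightarrow> (nat \<Rightarrow> real) measure \<Rightarrow> (nat \<Rightarrow> real) measure \<Rightarrow> real" where
  "wasserstein d p \<mu> \<nu> = enn2real (transport_cost d p \<mu> \<nu>) powr (1 / p)"

text \<open>
  For \<open>p > 1\<close> and \<open>\<mu>\<close> in \<open>P_space d p\<close> the minimizer is known to exist and to be unique, so the
  choice made by \<^const>\<open>arg_min\<close> is immaterial.
\<close>

definition projection :: "nat \<Rightarrow> real \<Rightarrow> (nat \<Rightarrow> real) measure \<Rightarrow> (nat \<Rightarrow> real) measure" where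
  "projection d p \<mu> = arg_min (\<lambda>\<rho>. transport_cost d p \<rho> \<mu>) (\<lambda>\<rho>. \<rho> \<in> K_space d p)"

end

theory Submission imports Defs begin

text \<open>
  Write \<open>|x|\<close> for \<open>norm_Rd d x\<close> and \<open>x\<^sub>0\<close> for the first coordinate. Fix \<open>s\<close> and \<open>R\<close>, let \<open>a\<close> be the
  point at height \<open>s\<close> on the first axis, put \<open>r\<^sup>2 = R\<^sup>2 + s\<^sup>2\<close>, and let \<open>U\<close> be the union of the balls
  \<open>B(0,R)\<close> and \<open>B(a,r)\<close>, scaled to volume 1. With the Kantorovich potential
  \<open>\<phi>(x) = min (|x|\<^sup>p - R\<^sup>p) (|x - a|\<^sup>p - r\<^sup>p)\<close> one sees that the projection of \<open>\<mu> = (1 - m) \<delta>\<^sub>0 + m \<delta>\<^sub>a\<close>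
  is the indicator of \<open>U = {\<phi> < 0}\<close>, where \<open>m\<close> is the volume of the part of \<open>U\<close> on which the second term of
  the minimum is the smaller one. The spheres meet in the hyperplane \<open>x\<^sub>0 = 0\<close>, and integrating over lines
  parallel to the first axis shows that the barycenter of \<open>U\<close> has height exactly \<open>s h\<close>, where \<open>h \<ge> 1/2\<close>
  is the volume of \<open>U \<inter> {x\<^sub>0 \<ge> 0}\<close>. For \<open>p = 2\<close> the two cells of \<open>U\<close> are separated by that hyperplane
  and \<open>m = h\<close>; for \<open>p < 2\<close> concavity of \<open>t \<mapsto> t\<^bsup>p/2\<^esup>\<close> pushes the interface upwards, and for \<open>p \<le> 3/2\<close>
  and \<open>s = R/(2d)\<close> this gains a volume \<open>h - m \<ge> 1/(384 d\<^sup>2)\<close>.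
  Compare \<open>\<mu>\<close> with \<open>\<nu> = \<delta>\<^sub>0\<close>, whose projection is a centered ball: the distance is at most \<open>s m\<^bsup>1/p\<^esup>\<close> before
  projecting, and at least \<open>s h\<close> afterwards, by comparing barycenters. As \<open>h\<^sup>p \<ge> h - (p - 1)\<close>, the
  distance grows as soon as \<open>p - 1 < 1/(384 d\<^sup>2)\<close>.
\<close>

section \<open>Lebesgue measure on coordinate space\<close>

text \<open>Without the root, balls are polynomial inequalities and \<open>p\<close>-th powers of
  distances become \<open>powr (p / 2)\<close> of polynomials.\<close>

definition sq_norm :: "nat \<Rightarrow> (nat \<Rightarrow> real) \<Rightarrow> real" where
  "sq_norm d x = (\<Sum>i<d. (x i)\<^sup>2)"

lemma sq_norm_nonneg: "0 \<le> sq_norm d x"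
  by (simp add: sq_norm_def sum_nonneg)

lemma measurable_component_Rd: "i < d \<Longrightarrow> (\<lambda>x. x i) \<in> borel_measurable (lborel_Rd d)"
proof -
  assume "i < d"
  then have "(\<lambda>x. x i) \<in> measurable (lborel_Rd d) lborel"
    by (intro measurable_component_singleton) auto
  then show ?thesis by simp
qed

lemma sets_lborel_Rd: "sets (lborel_Rd d) = sets (borel_Rd d)"
  by (intro sets_PiM_cong) auto

lemma measurable_component_borel_Rd:
  "i < d \<Longrightarrow> (\<lambda>x. x i) \<in> borel_measurable (borel_Rd d)"
  by (intro measurable_component_singleton) auto

lemma measurable_sq_norm [measurable]: "sq_norm d \<in> borel_measurable (lborel_Rd d)"
  unfolding sq_norm_def
  by (intro borel_measurable_sum borel_measurable_power measurable_component_Rd) auto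

lemma abs_component_le: "i < d \<Longrightarrow> \<bar>x i\<bar> \<le> sqrt (sq_norm d x)"
  unfolding sq_norm_def
  by (intro real_le_rsqrt, subst power2_abs) (rule member_le_sum[of i "{..<d}" "\<lambda>i. (x i)\<^sup>2"], auto)

interpretation lborel_factors: product_sigma_finite "\<lambda>_::nat. lborel :: real measure" by standard

text \<open>A product measure is determined by boxes, and on a box each factor scales separately.
  Diagonal maps cover the dilations, the reflection of the first coordinate and the flattening of a
  half ball that occur below.\<close>

lemma lborel_Rd_scale:
  assumes c: "\<And>i. i < d \<Longrightarrow> c i \<noteq> (0::real)"
  shows "lborel_Rd d =
    density (distr (lborel_Rd d) (lborel_Rd d) (\<lambda>x. \<lambda>i\<in>{..<d}. c i * x i)) (\<lambda>_. ennreal (\<Prod>i<d. \<bar>c i\<bar>))"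
    (is "_ = ?P")
proof (rule lborel_factors.PiM_eqI[symmetric])
  have T[measurable]: "(\<lambda>x. \<lambda>i\<in>{..<d}. c i * x i) \<in> measurable (lborel_Rd d) (lborel_Rd d)"
    by (rule measurable_restrict) simp
  fix A :: "nat \<Rightarrow> real set" assume "\<And>i. i \<in> {..<d} \<Longrightarrow> A i \<in> sets lborel"
  then have A[measurable]: "A i \<in> sets borel" if "i < d" for i using that by auto
  have PiA: "Pi\<^sub>E {..<d} A \<in> sets (lborel_Rd d)"
    by (intro sets_PiM_I_finite) (auto intro: A)
  have vim: "(\<lambda>x. c i * x) -` A i \<in> sets borel" if "i < d" for i
    using measurable_sets[of "\<lambda>x. c i * x" borel borel "A i"] that by simp
  have "emeasure ?P (Pi\<^sub>E {..<d} A) = ennreal (\<Prod>i<d. \<bar>c i\<bar>) *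
      emeasure (lborel_Rd d) ((\<lambda>x. \<lambda>i\<in>{..<d}. c i * x i) -` Pi\<^sub>E {..<d} A \<inter> space (lborel_Rd d))"
    using PiA by (simp add: emeasure_density_const emeasure_distr)
  also have "(\<lambda>x. \<lambda>i\<in>{..<d}. c i * x i) -` Pi\<^sub>E {..<d} A \<inter> space (lborel_Rd d)
      = Pi\<^sub>E {..<d} (\<lambda>i. (\<lambda>x. c i * x) -` A i)"
    by (auto simp: space_PiM PiE_iff)
  also have "emeasure (lborel_Rd d) \<dots> = (\<Prod>i<d. emeasure lborel ((\<lambda>x. c i * x) -` A i))"
    using vim by (intro lborel_factors.emeasure_PiM) auto
  also have "ennreal (\<Prod>i<d. \<bar>c i\<bar>) * \<dots>
      = (\<Prod>i<d. ennreal \<bar>c i\<bar> * emeasure lborel ((\<lambda>x. c i * x) -` A i))"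
    by (simp add: prod.distrib prod_ennreal)
  also have "\<dots> = (\<Prod>i<d. emeasure lborel (A i))"
  proof (rule prod.cong[OF refl])
    fix i assume i: "i \<in> {..<d}"
    have "emeasure lborel (A i) =
        emeasure (density (distr lborel borel (\<lambda>x. 0 + c i * x)) (\<lambda>_. ennreal \<bar>c i\<bar>)) (A i)"
      using lborel_real_affine[of "c i" 0] c i by simp
    also have "\<dots> = ennreal \<bar>c i\<bar> * emeasure lborel ((\<lambda>x. c i * x) -` A i)"
      using i by (simp add: emeasure_density_const emeasure_distr)
    finally show "ennreal \<bar>c i\<bar> * emeasure lborel ((\<lambda>x. c i * x) -` A i) = emeasure lborel (A i)" ..
  qed
  finally show "emeasure ?P (Pi\<^sub>E {..<d} A) = (\<Prod>i\<in>{..<d}. emeasure lborel (A i))" .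
qed auto

lemma emeasure_lborel_Rd_scale:
  assumes c: "\<And>i. i < d \<Longrightarrow> c i \<noteq> (0::real)" and A: "A \<in> sets (lborel_Rd d)"
  shows "emeasure (lborel_Rd d) A = ennreal (\<Prod>i<d. \<bar>c i\<bar>) *
    emeasure (lborel_Rd d) {x \<in> space (lborel_Rd d). (\<lambda>i\<in>{..<d}. c i * x i) \<in> A}"
proof -
  have T[measurable]: "(\<lambda>x. \<lambda>i\<in>{..<d}. c i * x i) \<in> measurable (lborel_Rd d) (lborel_Rd d)"
    by (rule measurable_restrict) simp
  have "(\<lambda>x. \<lambda>i\<in>{..<d}. c i * x i) -` A \<inter> space (lborel_Rd d) =
      {x \<in> space (lborel_Rd d). (\<lambda>i\<in>{..<d}. c i * x i) \<in> A}" by auto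
  note eq = this
  show ?thesis
    unfolding eq[symmetric]
    using A by (subst lborel_Rd_scale[OF c]) (simp_all add: emeasure_density_const emeasure_distr)
qed

lemma emeasure_lborel_Rd_bounded:
  assumes "\<And>x. x \<in> A \<Longrightarrow> sq_norm d x \<le> B" "A \<subseteq> space (lborel_Rd d)"
  shows "emeasure (lborel_Rd d) A < \<infinity>"
proof -
  let ?M = "sqrt B"
  have "A \<subseteq> Pi\<^sub>E {..<d} (\<lambda>_. {-?M..?M})"
  proof
    fix x assume x: "x \<in> A"
    have "\<bar>x i\<bar> \<le> ?M" if "i < d" for i
      using abs_component_le[OF that, of x] assms(1)[OF x] by (meson order_trans real_sqrt_le_mono)
    then have "x i \<in> {-?M..?M}" if "i < d" for i using that by (simp add: abs_le_iff minus_le_iff)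
    then show "x \<in> Pi\<^sub>E {..<d} (\<lambda>_. {-?M..?M})"
      using x assms(2) by (auto simp: space_PiM PiE_iff)
  qed
  then have "emeasure (lborel_Rd d) A \<le> emeasure (lborel_Rd d) (Pi\<^sub>E {..<d} (\<lambda>_. {-?M..?M}))"
    by (intro emeasure_mono sets_PiM_I_finite) auto
  also have "\<dots> = (\<Prod>i<d. emeasure lborel {-?M..?M})"
    by (intro lborel_factors.emeasure_PiM) auto
  also have "\<dots> < \<infinity>" by (auto simp: emeasure_lborel_Icc_eq ennreal_power)
  finally show ?thesis .
qed

text \<open>On the slice the integrand is minus half the derivative of
  \<open>b + 2 * s * max 0 t - t\<^sup>2\<close>, which vanishes at the ends of the slice. The set
  is the trace of the union of two balls on a line parallel to the first axis; \<open>b\<close> is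
  negative on lines that miss the ball around the origin.\<close>

lemma integral_slice_eq_0:
  fixes b s :: real
  assumes s: "0 \<le> s"
  shows "(\<integral>t. indicator {t. t\<^sup>2 < b + 2 * s * max 0 t} t * (t - (if 0 \<le> t then s else 0)) \<partial>lborel) = 0"
proof -
  define q where "q t = b + 2 * s * max 0 t - t\<^sup>2" for t :: real
  define F where "F t = indicator {t. t\<^sup>2 < b + 2 * s * max 0 t} t * (t - (if 0 \<le> t then s else 0))" for t :: real
  \<comment> \<open>From \<open>M\<close> outward
    \<open>(\<bar>t\<bar> - 2 * s) * \<bar>t\<bar>\<close> is at least
    \<open>\<bar>b\<bar> + 1\<close>, so \<open>q\<close> is negative there.\<close>
  define M where "M = \<bar>b\<bar> + 2 * s + 1"
  have M: "q t < 0" if t: "M \<le> \<bar>t\<bar>" for t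
  proof -
    have "(abs b + 1) * 1 \<le> (abs t - 2 * s) * abs t"
      using t s unfolding M_def by (intro mult_mono) auto
    moreover have "2 * s * max 0 t \<le> 2 * s * abs t" using s by (intro mult_left_mono) auto
    moreover have "t\<^sup>2 = abs t * abs t" by (simp add: power2_eq_square)
    moreover have "b \<le> abs b" by simp
    ultimately show ?thesis unfolding q_def left_diff_distrib by simp
  qed
  have M0: "0 \<le> M" using s by (simp add: M_def)
  have F_eq: "F t = (if 0 < q t then t - (if 0 \<le> t then s else 0) else 0)" for t
    by (simp add: F_def q_def indicator_def)
  have F_outside: "F t = 0" if "\<bar>t\<bar> \<ge> M" for t using M[OF that] by (simp add: F_eq)
  \<comment> \<open>The zeros of \<open>q\<close> are the kinks of \<open>max 0 (q t)\<close>, and 0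
    is the kink of \<open>max 0 t\<close> inside \<open>q\<close>.\<close>
  define S where "S = insert 0 {t. q t = 0}"
  have cq: "continuous_on X q" for X unfolding q_def by (intro continuous_intros)
  have opn: "open {t. q t < 0}" "open {t. 0 < q t}"
    by (intro open_Collect_less cq continuous_intros)+
  have "t \<in> {s + sqrt (b + s\<^sup>2), s - sqrt (b + s\<^sup>2), - sqrt b}" if "q t = 0" for t
  proof (cases "0 \<le> t")
    case True
    then have "(t - s)\<^sup>2 = b + s\<^sup>2" using that by (simp add: q_def power2_diff algebra_simps)
    then have "sqrt (b + s\<^sup>2) = \<bar>t - s\<bar>" by (metis real_sqrt_abs)
    then show ?thesis by auto
  next
    case False
    then have "t\<^sup>2 = b" using that by (simp add: q_def)
    then have "sqrt b = \<bar>t\<bar>" by (metis real_sqrt_abs)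
    then show ?thesis using False by auto
  qed
  then have "{t. q t = 0} \<subseteq> {s + sqrt (b + s\<^sup>2), s - sqrt (b + s\<^sup>2), - sqrt b}" by blast
  then have finS: "finite S" unfolding S_def by (metis finite.simps finite_subset)
  \<comment> \<open>Away from \<open>S\<close>, \<open>F\<close> is the derivative of \<open>- max 0 q / 2\<close>, which has compact support.\<close>
  have "(F has_integral (- (max 0 (q M)) / 2 - (- (max 0 (q (-M))) / 2))) {-M..M}"
  proof (rule fundamental_theorem_of_calculus_strong[OF finS, where f="\<lambda>t. - (max 0 (q t)) / 2"])
    show "continuous_on {-M..M} (\<lambda>t. - max 0 (q t) / 2)" by (intro continuous_intros cq) auto
    fix t assume "t \<in> {-M..M} - S"
    then have t: "q t \<noteq> 0" "t \<noteq> 0" by (auto simp: S_def)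
    consider "q t < 0" | "q t > 0" "t > 0" | "q t > 0" "t < 0" using t by linarith
    then show "((\<lambda>t. - max 0 (q t) / 2) has_vector_derivative F t) (at t)"
    proof cases
      case 1
      have "((\<lambda>t. 0) has_vector_derivative F t) (at t)" using 1 by (simp add: F_eq)
      then show ?thesis
        by (rule has_vector_derivative_transform_within_open[OF _ opn(1)]) (use 1 in auto)
    next
      case 2
      have "((\<lambda>t. - (b + 2 * s * t - t\<^sup>2) / 2) has_real_derivative F t) (at t)"
        using 2 by (auto intro!: derivative_eq_intros simp: F_eq)
      then show ?thesis
        unfolding has_real_derivative_iff_has_vector_derivative
        by (rule has_vector_derivative_transform_within_open[OF _ open_Int[OF opn(2) open_greaterThan[of 0]]])
           (use 2 in \<open>auto simp: q_def\<close>)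
    next
      case 3
      have "((\<lambda>t. - (b - t\<^sup>2) / 2) has_real_derivative F t) (at t)"
        using 3 by (auto intro!: derivative_eq_intros simp: F_eq)
      then show ?thesis
        unfolding has_real_derivative_iff_has_vector_derivative
        by (rule has_vector_derivative_transform_within_open[OF _ open_Int[OF opn(2) open_lessThan[of 0]]])
           (use 3 in \<open>auto simp: q_def\<close>)
    qed
  qed (use M0 in auto)
  then have "(F has_integral 0) {-M..M}" using M[of M] M[of "-M"] M0 by simp
  then have 0: "(F has_integral 0) UNIV"
    by (rule has_integral_on_superset) (auto intro!: F_outside)
  have "integrable lborel F"
  proof (rule integrableI_bounded_set[of "{-M..M}" _ _ "M + s"])
    show "F \<in> borel_measurable lborel" unfolding F_def by measurable
    show "AE x in lborel. x \<in> {-M..M} \<longrightarrow> norm (F x) \<le> M + s"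
      using s by (auto simp: F_eq)
    show "AE x in lborel. x \<notin> {-M..M} \<longrightarrow> F x = 0" by (auto intro!: F_outside)
  qed (auto simp: emeasure_lborel_Icc_eq)
  then have "(F has_integral integral\<^sup>L lborel F) UNIV" by (rule has_integral_integral_lborel)
  with 0 have "integral\<^sup>L lborel F = 0" by (metis has_integral_unique)
  then show ?thesis by (simp add: F_def[abs_def])
qed

lemma sq_norm_update:
  assumes "0 < d"
  shows "sq_norm d (x(0 := t)) = t\<^sup>2 + (\<Sum>i\<in>{1..<d}. (x i)\<^sup>2)"
proof -
  have "{..<d} = insert 0 {1..<d}" using assms by auto
  then show ?thesis by (simp add: sq_norm_def)
qed

text \<open>The quadratic estimate for a slice applies to the norm of \<open>x\<close>, which
  dominates \<open>x 0\<close>. The resulting bounded support gives integrability, finite volume and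
  finite moments.\<close>

lemma sq_norm_le_of_paraboloid:
  assumes "0 < d" "0 \<le> s" "sq_norm d x < b + 2 * s * max 0 (x 0)"
  shows "sq_norm d x \<le> (\<bar>b\<bar> + 2 * s + 1)\<^sup>2"
proof (rule ccontr)
  define n where "n = sqrt (sq_norm d x)"
  have n: "0 \<le> n" "sq_norm d x = n\<^sup>2" by (simp_all add: n_def sq_norm_nonneg)
  assume "\<not> ?thesis"
  then have "\<bar>b\<bar> + 2 * s + 1 < n" using n(1) unfolding n(2) by (smt (verit) power_mono)
  then have "(\<bar>b\<bar> + 1) * 1 \<le> (n - 2 * s) * n" using assms(2) by (intro mult_mono) auto
  moreover have "2 * s * max 0 (x 0) \<le> 2 * s * n"
    using abs_component_le[OF assms(1), of x] n(1) assms(2) by (intro mult_left_mono) (auto simp: n_def)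
  ultimately show False using assms(3) unfolding n(2) by (simp add: algebra_simps power2_eq_square)
qed

text \<open>Fubini along the first axis: fixing the other coordinates lowers \<open>b\<close> by the
  sum of their squares, and every slice integrates to 0. Hence the first moment of the set is
  \<open>s\<close> times the volume of its part in \<open>0 \<le> x 0\<close>.\<close>

lemma integral_paraboloid_eq_0:
  assumes d: "0 < d" and s: "0 \<le> s"
  shows "(\<integral>x. indicator {x. sq_norm d x < b + 2 * s * max 0 (x 0)} x * (x 0 - (if 0 \<le> x 0 then s else 0))
    \<partial>lborel_Rd d) = 0" (is "integral\<^sup>L _ ?F = 0")
    and "integrable (lborel_Rd d) (\<lambda>x. indicator {x. sq_norm d x < b + 2 * s * max 0 (x 0)} x * (x 0 - (if 0 \<le> x 0 then s else 0)))"
proof -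
  let ?I = "{1..<d}"
  have I: "{..<d} = insert 0 ?I" using d by auto
  note [measurable] = measurable_component_Rd[OF d]
  let ?U = "{x \<in> space (lborel_Rd d). sq_norm d x < b + 2 * s * max 0 (x 0)}"
  show int: "integrable (lborel_Rd d) ?F"
  proof (rule integrableI_bounded_set[of ?U _ _ "\<bar>b\<bar> + 2 * s + 1 + s"])
    show "?U \<in> sets (lborel_Rd d)" by measurable
    have "(\<lambda>x. indicator ?U x * (x 0 - (if 0 \<le> x 0 then s else 0))) \<in> borel_measurable (lborel_Rd d)"
      by measurable
    then show "?F \<in> borel_measurable (lborel_Rd d)"
      by (rule measurable_cong[THEN iffD1, rotated]) (auto simp: indicator_def)
    show "emeasure (lborel_Rd d) ?U < \<infinity>"
      by (rule emeasure_lborel_Rd_bounded[where B="(\<bar>b\<bar> + 2 * s + 1)\<^sup>2"])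
         (auto intro: sq_norm_le_of_paraboloid[OF d s])
    show "AE x in lborel_Rd d. x \<in> ?U \<longrightarrow> norm (?F x) \<le> \<bar>b\<bar> + 2 * s + 1 + s"
    proof (intro AE_I2 impI)
      fix x assume "x \<in> ?U"
      then have "sq_norm d x \<le> (\<bar>b\<bar> + 2 * s + 1)\<^sup>2" using sq_norm_le_of_paraboloid[OF d s] by auto
      then have "sqrt (sq_norm d x) \<le> \<bar>b\<bar> + 2 * s + 1" using s by (intro real_le_lsqrt) auto
      then have "\<bar>x 0\<bar> \<le> \<bar>b\<bar> + 2 * s + 1" using abs_component_le[OF d, of x] by linarith
      then show "norm (?F x) \<le> \<bar>b\<bar> + 2 * s + 1 + s" using s by (auto simp: indicator_def)
    qed
  qed (auto simp: indicator_def)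
  have slice: "(\<integral>t. ?F (x(0 := t)) \<partial>lborel) = 0" for x
  proof -
    have "(\<lambda>t. ?F (x(0 := t))) = (\<lambda>t. indicator {t. t\<^sup>2 < (b - (\<Sum>i\<in>{1..<d}. (x i)\<^sup>2)) + 2 * s * max 0 t} t *
      (t - (if 0 \<le> t then s else 0)))"
      unfolding fun_eq_iff by (auto simp: sq_norm_update[OF d] indicator_def)
    then show ?thesis by (simp only: integral_slice_eq_0[OF s])
  qed
  have "integral\<^sup>L (lborel_Rd d) ?F = integral\<^sup>L (Pi\<^sub>M (insert 0 ?I) (\<lambda>_. lborel)) ?F"
    by (simp only: I)
  also have "\<dots> = (\<integral>x. (\<integral>t. ?F (x(0 := t)) \<partial>lborel) \<partial>Pi\<^sub>M ?I (\<lambda>_. lborel))"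
    using int unfolding I by (intro lborel_factors.product_integral_insert) auto
  finally show "integral\<^sup>L (lborel_Rd d) ?F = 0" by (simp only: slice) simp
qed

section \<open>Couplings and transport cost\<close>

lemma dist_Rd_eq: "dist_Rd d x y = sqrt (sq_norm d (\<lambda>i. x i - y i))"
  by (simp add: dist_Rd_def sq_norm_def L2_set_def)

lemma norm_Rd_eq: "norm_Rd d x = sqrt (sq_norm d x)"
  by (simp add: norm_Rd_def sq_norm_def L2_set_def)

lemma dist_Rd_nonneg: "0 \<le> dist_Rd d x y"
  by (simp add: dist_Rd_def L2_set_nonneg)

lemma component_diff_le_dist_Rd: "i < d \<Longrightarrow> \<bar>x i - y i\<bar> \<le> dist_Rd d x y"
  unfolding dist_Rd_eq using abs_component_le[of i d "\<lambda>i. x i - y i"] by simp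

lemma dist_Rd_triangle: "dist_Rd d x y \<le> norm_Rd d x + norm_Rd d y"
  using L2_set_triangle_ineq[of x "\<lambda>i. - y i" "{..<d}"]
  by (simp add: dist_Rd_def norm_Rd_def L2_set_def)

lemma measurable_dist_Rd [measurable]:
  "(\<lambda>z. dist_Rd d (fst z) (snd z)) \<in> borel_measurable (borel_Rd d \<Otimes>\<^sub>M borel_Rd d)"
proof -
  have "(\<lambda>z. fst z i - snd z i) \<in> borel_measurable (borel_Rd d \<Otimes>\<^sub>M borel_Rd d)" if "i < d" for i
    using measurable_compose[OF measurable_fst measurable_component_borel_Rd[OF that]]
      measurable_compose[OF measurable_snd measurable_component_borel_Rd[OF that]]
    by (intro borel_measurable_diff)
  then show ?thesis
    unfolding dist_Rd_def L2_set_def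
    by (intro borel_measurable_sqrt[THEN measurable_compose[rotated]] borel_measurable_sum borel_measurable_power) auto
qed

lemma measurable_borel_Rd_iff: "f \<in> measurable (borel_Rd d) N \<longleftrightarrow> f \<in> measurable (lborel_Rd d) N"
  using measurable_cong_sets[OF sets_lborel_Rd[of d] refl, of N] by auto

lemma couplings_measurable:
  assumes "\<gamma> \<in> couplings d \<mu> \<nu>"
  shows "fst \<in> measurable \<gamma> (borel_Rd d)" "snd \<in> measurable \<gamma> (borel_Rd d)"
    "(\<lambda>z. dist_Rd d (fst z) (snd z)) \<in> borel_measurable \<gamma>"
  using assms measurable_cong_sets[of \<gamma> "borel_Rd d \<Otimes>\<^sub>M borel_Rd d"]
  by (auto simp: couplings_def)

lemma couplings_nn_integral:
  assumes "\<gamma> \<in> couplings d \<mu> \<nu>" and f: "f \<in> borel_measurable (borel_Rd d)"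
  shows "(\<integral>\<^sup>+z. f (fst z) \<partial>\<gamma>) = (\<integral>\<^sup>+x. f x \<partial>\<mu>)" "(\<integral>\<^sup>+z. f (snd z) \<partial>\<gamma>) = (\<integral>\<^sup>+x. f x \<partial>\<nu>)"
proof -
  note m = couplings_measurable[OF assms(1)]
  have "distr \<gamma> (borel_Rd d) fst = \<mu>" "distr \<gamma> (borel_Rd d) snd = \<nu>"
    using assms(1) by (auto simp: couplings_def)
  note e = this
  show "(\<integral>\<^sup>+z. f (fst z) \<partial>\<gamma>) = (\<integral>\<^sup>+x. f x \<partial>\<mu>)" "(\<integral>\<^sup>+z. f (snd z) \<partial>\<gamma>) = (\<integral>\<^sup>+x. f x \<partial>\<nu>)"
    unfolding e[symmetric] using m f by (simp_all add: nn_integral_distr)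
qed

lemma couplings_AE:
  assumes "\<gamma> \<in> couplings d \<mu> \<nu>" and P: "{x \<in> space (borel_Rd d). P x} \<in> sets (borel_Rd d)"
  shows "(AE z in \<gamma>. P (fst z)) \<longleftrightarrow> (AE x in \<mu>. P x)" "(AE z in \<gamma>. P (snd z)) \<longleftrightarrow> (AE x in \<nu>. P x)"
proof -
  note m = couplings_measurable[OF assms(1)]
  have "distr \<gamma> (borel_Rd d) fst = \<mu>" "distr \<gamma> (borel_Rd d) snd = \<nu>"
    using assms(1) by (auto simp: couplings_def)
  note e = this
  show "(AE z in \<gamma>. P (fst z)) \<longleftrightarrow> (AE x in \<mu>. P x)" "(AE z in \<gamma>. P (snd z)) \<longleftrightarrow> (AE x in \<nu>. P x)"
    unfolding e[symmetric] using AE_distr_iff[OF m(1) P] AE_distr_iff[OF m(2) P] by simp_all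
qed

lemma couplings_integral:
  fixes f :: "(nat \<Rightarrow> real) \<Rightarrow> real"
  assumes "\<gamma> \<in> couplings d \<mu> \<nu>" and f: "f \<in> borel_measurable (borel_Rd d)"
  shows "integrable \<gamma> (\<lambda>z. f (fst z)) \<longleftrightarrow> integrable \<mu> f" "integrable \<gamma> (\<lambda>z. f (snd z)) \<longleftrightarrow> integrable \<nu> f"
    "(\<integral>z. f (fst z) \<partial>\<gamma>) = (\<integral>x. f x \<partial>\<mu>)" "(\<integral>z. f (snd z) \<partial>\<gamma>) = (\<integral>x. f x \<partial>\<nu>)"
proof -
  note m = couplings_measurable[OF assms(1)]
  have "distr \<gamma> (borel_Rd d) fst = \<mu>" "distr \<gamma> (borel_Rd d) snd = \<nu>"
    using assms(1) by (auto simp: couplings_def)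
  then show "integrable \<gamma> (\<lambda>z. f (fst z)) \<longleftrightarrow> integrable \<mu> f" "integrable \<gamma> (\<lambda>z. f (snd z)) \<longleftrightarrow> integrable \<nu> f"
    "(\<integral>z. f (fst z) \<partial>\<gamma>) = (\<integral>x. f x \<partial>\<mu>)" "(\<integral>z. f (snd z) \<partial>\<gamma>) = (\<integral>x. f x \<partial>\<nu>)"
    using integrable_distr_eq[OF m(1) f] integrable_distr_eq[OF m(2) f]
      integral_distr[OF m(1) f] integral_distr[OF m(2) f] by simp_all
qed

lemma couplings_prob_space:
  assumes "\<gamma> \<in> couplings d \<mu> \<nu>" "prob_space \<mu>"
  shows "prob_space \<gamma>"
  using couplings_measurable(1)[OF assms(1)] assms prob_space_distrD[of fst \<gamma> "borel_Rd d"]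
  by (auto simp: couplings_def)

lemma transport_cost_le:
  assumes "\<gamma> \<in> couplings d \<mu> \<nu>"
  shows "transport_cost d p \<mu> \<nu> \<le> (\<integral>\<^sup>+z. ennreal (dist_Rd d (fst z) (snd z) powr p) \<partial>\<gamma>)"
  unfolding transport_cost_def by (rule INF_lower) fact

lemma distr_coupling:
  assumes S: "S \<in> measurable M (borel_Rd d)" and T: "T \<in> measurable M (borel_Rd d)"
  shows "distr M (borel_Rd d \<Otimes>\<^sub>M borel_Rd d) (\<lambda>x. (S x, T x))
    \<in> couplings d (distr M (borel_Rd d) S) (distr M (borel_Rd d) T)"
  using S T by (auto simp: couplings_def distr_distr o_def)

text \<open>Pairing two maps on one source gives a coupling of their images. With \<open>S\<close>
  the identity it bounds the cost of the projection plan; with \<open>T\<close> constant, the cost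
  of collapsing onto the origin.\<close>

lemma transport_cost_distr_le:
  assumes S: "S \<in> measurable M (borel_Rd d)" and T: "T \<in> measurable M (borel_Rd d)"
  shows "transport_cost d p (distr M (borel_Rd d) S) (distr M (borel_Rd d) T)
    \<le> (\<integral>\<^sup>+x. ennreal (dist_Rd d (S x) (T x) powr p) \<partial>M)"
proof -
  have "(\<integral>\<^sup>+z. ennreal (dist_Rd d (fst z) (snd z) powr p) \<partial>distr M (borel_Rd d \<Otimes>\<^sub>M borel_Rd d) (\<lambda>x. (S x, T x)))
      = (\<integral>\<^sup>+x. ennreal (dist_Rd d (S x) (T x) powr p) \<partial>M)"
    using S T by (subst nn_integral_distr) auto
  with transport_cost_le[OF distr_coupling[OF S T], of p] show ?thesis by simp
qed

text \<open>
  Since \<^const>\<open>ennreal\<close> truncates at 0, \<open>ennreal (\<phi> x)\<close> and \<open>ennreal (- \<phi> x)\<close> are the positive and the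
  negative part of \<open>\<phi>\<close>. Keeping them on different sides avoids integrability assumptions on \<open>\<phi>\<close>.
\<close>

lemma transport_cost_dual_le:
  fixes \<phi> \<omega> :: "(nat \<Rightarrow> real) \<Rightarrow> real"
  assumes \<phi>[measurable]: "\<phi> \<in> borel_measurable (borel_Rd d)" and \<omega>[measurable]: "\<omega> \<in> borel_measurable (borel_Rd d)"
    and S: "S \<in> sets (borel_Rd d)" "AE y in \<mu>. y \<in> S"
    and dual: "\<And>x y. y \<in> S \<Longrightarrow> \<phi> x + \<omega> y \<le> dist_Rd d x y powr p"
    and \<omega>0: "\<And>y. 0 \<le> \<omega> y"
  shows "(\<integral>\<^sup>+x. ennreal (\<phi> x) \<partial>\<rho>) + (\<integral>\<^sup>+y. ennreal (\<omega> y) \<partial>\<mu>)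
    \<le> transport_cost d p \<rho> \<mu> + (\<integral>\<^sup>+x. ennreal (- \<phi> x) \<partial>\<rho>)" (is "?A \<le> _ + ?B")
\<comment> \<open>An infinite negative part makes the bound trivial; a finite one may be subtracted
  in \<open>ennreal\<close>.\<close>
proof (cases "?B = \<infinity>")
  case False
  have "?A - ?B \<le> (\<integral>\<^sup>+z. ennreal (dist_Rd d (fst z) (snd z) powr p) \<partial>\<gamma>)" if \<gamma>: "\<gamma> \<in> couplings d \<rho> \<mu>" for \<gamma>
  proof -
    note [measurable] = couplings_measurable[OF \<gamma>]
    have "AE z in \<gamma>. snd z \<in> S"
      using couplings_AE(2)[OF \<gamma>, of "\<lambda>y. y \<in> S"] S sets.sets_into_space[OF S(1)] by (simp add: Int_absorb1 Collect_conj_eq)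
    have "?A = (\<integral>\<^sup>+z. ennreal (\<phi> (fst z)) \<partial>\<gamma>) + (\<integral>\<^sup>+z. ennreal (\<omega> (snd z)) \<partial>\<gamma>)"
      using couplings_nn_integral(1)[OF \<gamma>, of "\<lambda>x. ennreal (\<phi> x)"]
        couplings_nn_integral(2)[OF \<gamma>, of "\<lambda>x. ennreal (\<omega> x)"] by simp
    also have "\<dots> = (\<integral>\<^sup>+z. ennreal (\<phi> (fst z)) + ennreal (\<omega> (snd z)) \<partial>\<gamma>)"
      by (rule nn_integral_add[symmetric]) measurable
    also have "\<dots> \<le> (\<integral>\<^sup>+z. ennreal (dist_Rd d (fst z) (snd z) powr p) + ennreal (- \<phi> (fst z)) \<partial>\<gamma>)"
    proof (rule nn_integral_mono_AE)
      show "AE z in \<gamma>. ennreal (\<phi> (fst z)) + ennreal (\<omega> (snd z))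
          \<le> ennreal (dist_Rd d (fst z) (snd z) powr p) + ennreal (- \<phi> (fst z))"
        using \<open>AE z in \<gamma>. snd z \<in> S\<close>
      proof eventually_elim
        case (elim z)
        show ?case using dual[OF elim, of "fst z"] \<omega>0[of "snd z"]
          by (cases "0 \<le> \<phi> (fst z)")
            (auto simp: ennreal_plus[symmetric] ennreal_neg simp del: ennreal_plus intro!: ennreal_leI)
      qed
    qed
    also have "\<dots> = (\<integral>\<^sup>+z. ennreal (dist_Rd d (fst z) (snd z) powr p) \<partial>\<gamma>) + (\<integral>\<^sup>+z. ennreal (- \<phi> (fst z)) \<partial>\<gamma>)"
      by (rule nn_integral_add) measurable
    also have "(\<integral>\<^sup>+z. ennreal (- \<phi> (fst z)) \<partial>\<gamma>) = ?B"
      by (rule couplings_nn_integral(1)[OF \<gamma>, of "\<lambda>x. ennreal (- \<phi> x)"]) measurable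
    finally show ?thesis using False by (simp add: ennreal_minus_le_iff add.commute)
  qed
  then have "?A - ?B \<le> transport_cost d p \<rho> \<mu>" unfolding transport_cost_def by (rule INF_greatest)
  then show ?thesis using False by (simp add: ennreal_minus_le_iff add.commute)
qed simp

lemma pair_measure_couplings:
  assumes "prob_space M" "prob_space N" "sets M = sets (borel_Rd d)" "sets N = sets (borel_Rd d)"
  shows "M \<Otimes>\<^sub>M N \<in> couplings d M N"
proof -
  interpret M: prob_space M by fact
  interpret N: prob_space N by fact
  interpret pair_prob_space M N ..
  have "distr (M \<Otimes>\<^sub>M N) (borel_Rd d) fst = distr (M \<Otimes>\<^sub>M N) M fst"
    "distr (M \<Otimes>\<^sub>M N) (borel_Rd d) snd = distr (M \<Otimes>\<^sub>M N) N snd"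
    using assms by (auto intro!: distr_cong)
  moreover have "distr (M \<Otimes>\<^sub>M N) N snd = N"
  proof (rule measure_eqI)
    fix A assume "A \<in> sets (distr (M \<Otimes>\<^sub>M N) N snd)"
    then have A: "A \<in> sets N" by simp
    then have "snd -` A \<inter> space (M \<Otimes>\<^sub>M N) = space M \<times> A"
      using sets.sets_into_space[OF A] by (auto simp: space_pair_measure)
    with A show "emeasure (distr (M \<Otimes>\<^sub>M N) N snd) A = emeasure N A"
      by (simp add: emeasure_distr N.emeasure_pair_measure_Times M.emeasure_space_1)
  qed simp
  moreover have "distr (M \<Otimes>\<^sub>M N) M fst = M" by (rule N.distr_pair_fst)
  ultimately show ?thesis using assms by (simp add: couplings_def cong: sets_pair_measure_cong)
qed

text \<open>\<open>enn2real\<close> sends infinity to 0, so a lower bound on the cost passes to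
  \<open>wasserstein\<close> only once the cost is known to be finite. The product coupling shows
  this for bounded supports.\<close>

lemma transport_cost_finite:
  assumes "prob_space \<mu>" "prob_space \<nu>" "sets \<mu> = sets (borel_Rd d)" "sets \<nu> = sets (borel_Rd d)"
    and B: "AE x in \<mu>. sq_norm d x \<le> B" "AE x in \<nu>. sq_norm d x \<le> B" and p: "0 \<le> p"
  shows "transport_cost d p \<mu> \<nu> < \<infinity>"
proof -
  let ?\<gamma> = "\<mu> \<Otimes>\<^sub>M \<nu>"
  have \<gamma>: "?\<gamma> \<in> couplings d \<mu> \<nu>" using assms by (intro pair_measure_couplings)
  interpret prob_space ?\<gamma> by (rule couplings_prob_space[OF \<gamma> assms(1)])
  have [measurable]: "sq_norm d \<in> borel_measurable (borel_Rd d)"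
    by (simp add: measurable_borel_Rd_iff)
  have meas: "{x \<in> space (borel_Rd d). sq_norm d x \<le> B} \<in> sets (borel_Rd d)" by measurable
  have "AE z in ?\<gamma>. sq_norm d (fst z) \<le> B" "AE z in ?\<gamma>. sq_norm d (snd z) \<le> B"
    using B couplings_AE[OF \<gamma> meas] by auto
  then have "AE z in ?\<gamma>. ennreal (dist_Rd d (fst z) (snd z) powr p) \<le> ennreal ((2 * sqrt B) powr p)"
  proof eventually_elim
    case (elim z)
    then have "dist_Rd d (fst z) (snd z) \<le> 2 * sqrt B"
      using dist_Rd_triangle[of d "fst z" "snd z"] real_sqrt_le_mono[OF elim(1)] real_sqrt_le_mono[OF elim(2)]
      unfolding norm_Rd_eq by linarith
    then show ?case using p by (intro ennreal_leI powr_mono2 dist_Rd_nonneg)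
  qed
  then have "(\<integral>\<^sup>+z. ennreal (dist_Rd d (fst z) (snd z) powr p) \<partial>?\<gamma>) \<le> (\<integral>\<^sup>+z. ennreal ((2 * sqrt B) powr p) \<partial>?\<gamma>)"
    by (rule nn_integral_mono_AE)
  also have "\<dots> < \<infinity>" by (simp add: emeasure_space_1)
  finally show ?thesis using transport_cost_le[OF \<gamma>, of p] by (rule le_less_trans[rotated])
qed

lemma P_spaceI:
  assumes "prob_space \<mu>" "sets \<mu> = sets (borel_Rd d)" "AE x in \<mu>. sq_norm d x \<le> B" "0 \<le> p"
  shows "\<mu> \<in> P_space d p"
proof -
  interpret prob_space \<mu> by fact
  have "(\<integral>\<^sup>+x. ennreal (norm_Rd d x powr p) \<partial>\<mu>) \<le> (\<integral>\<^sup>+x. ennreal (sqrt B powr p) \<partial>\<mu>)"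
    using assms(3)
    by (intro nn_integral_mono_AE, eventually_elim)
       (auto simp: norm_Rd_eq sq_norm_nonneg intro!: ennreal_leI powr_mono2 assms(4))
  also have "\<dots> < \<infinity>" by (simp add: emeasure_space_1)
  finally show ?thesis using assms by (simp add: P_space_def)
qed

text \<open>All couplings have the same mean displacement along the first axis, and the distance
  dominates that component. Convexity of the power then bounds the cost of each coupling from
  below.\<close>

lemma transport_cost_ge_mean_diff:
  assumes "prob_space \<mu>" and d: "0 < d" and p: "1 \<le> p"
    and int: "integrable \<mu> (\<lambda>x. x 0)" "integrable \<nu> (\<lambda>x. x 0)"
    and t: "0 < t" "t \<le> (\<integral>x. x 0 \<partial>\<mu>) - (\<integral>x. x 0 \<partial>\<nu>)"
  shows "ennreal (t powr p) \<le> transport_cost d p \<mu> \<nu>"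
  unfolding transport_cost_def
proof (rule INF_greatest)
  fix \<gamma> assume \<gamma>: "\<gamma> \<in> couplings d \<mu> \<nu>"
  note [measurable] = couplings_measurable[OF \<gamma>]
  note c = couplings_integral[OF \<gamma> measurable_component_borel_Rd[OF d]]
  interpret prob_space \<gamma> by (rule couplings_prob_space[OF \<gamma> assms(1)])
  define g where "g z = t powr p + p * t powr (p - 1) * (fst z 0 - snd z 0 - t)" for z :: "(nat \<Rightarrow> real) \<times> (nat \<Rightarrow> real)"
  have int': "integrable \<gamma> g"
    using int c unfolding g_def by simp
  have g_le: "g z \<le> dist_Rd d (fst z) (snd z) powr p" for z
  proof -
    let ?u = "dist_Rd d (fst z) (snd z)"
    have "g z \<le> t powr p + p * t powr (p - 1) * (?u - t)"
      using component_diff_le_dist_Rd[OF d, of "fst z" "snd z"] p unfolding g_def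
      by (intro add_left_mono mult_left_mono) auto
    \<comment> \<open>The tangent of \<open>u powr p\<close> at \<open>t\<close> replaces Jensen's inequality.\<close>
    also have "\<dots> \<le> ?u powr p"
    \<comment> \<open>At \<open>?u = 0\<close>, outside the open half-line of the tangent argument,
      the claim reads \<open>(1 - p) * t powr p \<le> 0\<close>.\<close>
    proof (cases "?u = 0")
      case True
      have "t powr p = t powr (p - 1) * t" using t by (simp add: powr_mult_base[symmetric] powr_diff)
      then show ?thesis using True p t by (simp add: mult_right_mono algebra_simps)
    next
      case False
      then have u: "?u > 0" using dist_Rd_nonneg[of d "fst z" "snd z"] by simp
      have "(\<lambda>x. x powr p) (?u) - t powr p \<ge> p * t powr (p - 1) * (?u - t)"
        by (rule convex_on_imp_above_tangent[of "{0<..}"])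
           (use t u p in \<open>auto intro!: derivative_eq_intros powr_convex simp: interior_open\<close>)
      then show ?thesis by simp
    qed
    finally show ?thesis .
  qed
  have "t powr p \<le> t powr p + p * t powr (p - 1) * ((\<integral>x. x 0 \<partial>\<mu>) - (\<integral>x. x 0 \<partial>\<nu>) - t)"
    using t p by simp
  also have "\<dots> = integral\<^sup>L \<gamma> g"
    unfolding g_def using int c by (simp add: prob_space)
  finally have "ennreal (t powr p) \<le> ennreal (integral\<^sup>L \<gamma> g)" by (rule ennreal_leI)
  \<comment> \<open>\<open>g\<close> may be negative, so its positive part is taken before passing
    to the nonnegative integral.\<close>
  also have "\<dots> \<le> ennreal (\<integral>z. max 0 (g z) \<partial>\<gamma>)"
    using int' by (intro ennreal_leI integral_mono) auto
  also have "\<dots> = (\<integral>\<^sup>+z. ennreal (max 0 (g z)) \<partial>\<gamma>)"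
    using int' by (intro nn_integral_eq_integral[symmetric]) auto
  also have "\<dots> \<le> (\<integral>\<^sup>+z. ennreal (dist_Rd d (fst z) (snd z) powr p) \<partial>\<gamma>)"
    using g_le by (intro nn_integral_mono ennreal_leI) auto
  finally show "ennreal (t powr p) \<le> (\<integral>\<^sup>+z. ennreal (dist_Rd d (fst z) (snd z) powr p) \<partial>\<gamma>)" .
qed

section \<open>Projections by duality\<close>

definition saturated :: "nat \<Rightarrow> (nat \<Rightarrow> real) set \<Rightarrow> (nat \<Rightarrow> real) measure" where
  "saturated d U = density (lborel_Rd d) (\<lambda>x. ennreal (indicator U x))"

text \<open>Weak duality with complementary slackness. A density between 0 and 1 collects the most
  from the negative part of \<open>\<phi>\<close> by being 1 on \<open>U\<close>, and the plan
  \<open>x \<mapsto> T x\<close> turns the dual inequality into an equality there. Uniqueness of the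
  minimizer is derived as well, since \<open>arg_min\<close> could otherwise return another
  one.\<close>

lemma projection_eqI:
  fixes \<phi> \<omega> :: "(nat \<Rightarrow> real) \<Rightarrow> real" and S :: "(nat \<Rightarrow> real) set"
  assumes \<phi>[measurable]: "\<phi> \<in> borel_measurable (lborel_Rd d)" and \<omega>[measurable]: "\<omega> \<in> borel_measurable (borel_Rd d)"
    and U: "U = {x \<in> space (lborel_Rd d). \<phi> x < 0}" and vol: "emeasure (lborel_Rd d) U = 1"
    and T[measurable]: "T \<in> measurable (lborel_Rd d) (borel_Rd d)" and S: "S \<in> sets (borel_Rd d)" "\<And>x. T x \<in> S"
    and dual: "\<And>x y. y \<in> S \<Longrightarrow> \<phi> x + \<omega> y \<le> dist_Rd d x y powr p"
    and contact: "\<And>x. x \<in> U \<Longrightarrow> \<phi> x + \<omega> (T x) = dist_Rd d x (T x) powr p"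
    and B: "\<And>x. - B \<le> \<phi> x" "\<And>y. 0 \<le> \<omega> y" "\<And>y. \<omega> y \<le> B"
    and K: "saturated d U \<in> K_space d p"
  shows "projection d p (distr (saturated d U) (borel_Rd d) T) = saturated d U"
proof -
  let ?L = "lborel_Rd d"
  define \<mu> where "\<mu> = distr (saturated d U) (borel_Rd d) T"
  define k where "k = (\<integral>\<^sup>+x. ennreal (- \<phi> x) \<partial>?L)"
  define c where "c = (\<integral>\<^sup>+x. ennreal (dist_Rd d x (T x) powr p) \<partial>saturated d U)"
  define \<Omega> where "\<Omega> = (\<integral>\<^sup>+y. ennreal (\<omega> y) \<partial>\<mu>)"
  have [measurable]: "U \<in> sets ?L" unfolding U by measurable
  have \<rho>_sets: "sets (saturated d U) = sets ?L" "space (saturated d U) = space ?L" by (simp_all add: saturated_def)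
  have \<rho>_borel: "sets (saturated d U) = sets (borel_Rd d)" using \<rho>_sets(1) sets_lborel_Rd by simp
  have T\<rho>[measurable]: "T \<in> measurable (saturated d U) (borel_Rd d)" using T by (simp add: saturated_def)
  have id\<rho>: "(\<lambda>x. x) \<in> measurable (saturated d U) (borel_Rd d)" by (rule measurable_ident_sets[OF \<rho>_borel])
  interpret \<rho>: prob_space "saturated d U"
    using K by (simp add: K_space_def P_space_def)
  interpret \<mu>: prob_space \<mu> unfolding \<mu>_def by (rule \<rho>.prob_space_distr) measurable
  have \<phi>b: "\<phi> \<in> borel_measurable (borel_Rd d)" by (simp add: measurable_borel_Rd_iff)
  have neg_outside: "ennreal (- \<phi> x) = ennreal (- \<phi> x) * indicator U x" if "x \<in> space ?L" for x
    using that by (auto simp: U indicator_def ennreal_neg)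
  have "k = (\<integral>\<^sup>+x. ennreal (- \<phi> x) * indicator U x \<partial>?L)"
    unfolding k_def by (rule nn_integral_cong) (rule neg_outside)
  also have "\<dots> \<le> (\<integral>\<^sup>+x. ennreal B * indicator U x \<partial>?L)"
  proof (intro nn_integral_mono mult_right_mono ennreal_leI)
    fix x show "- \<phi> x \<le> B" using B(1)[of x] by simp
  qed simp
  also have "\<dots> = ennreal B" by (simp add: nn_integral_cmult vol)
  finally have k_fin: "k < \<infinity>" by (rule le_less_trans) simp
  have "\<Omega> \<le> (\<integral>\<^sup>+y. ennreal B \<partial>\<mu>)" unfolding \<Omega>_def by (intro nn_integral_mono ennreal_leI B)
  then have \<Omega>_fin: "\<Omega> < \<infinity>" by (rule le_less_trans) (simp add: \<mu>.emeasure_space_1)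
  have dist_meas[measurable]: "(\<lambda>x. dist_Rd d x (T x)) \<in> borel_measurable ?L"
    using measurable_compose[OF measurable_Pair[OF id\<rho> T\<rho>] measurable_dist_Rd] by (simp add: saturated_def)
  \<comment> \<open>The contact identity integrated over \<open>U\<close>, with the negative term
    moved across so that all terms stay in \<open>ennreal\<close>; outside \<open>U\<close> every
    term is 0.\<close>
  have c_k: "c + k = \<Omega>"
  proof -
    have "c + k = (\<integral>\<^sup>+x. indicator U x * ennreal (dist_Rd d x (T x) powr p) + ennreal (- \<phi> x) \<partial>?L)"
      unfolding c_def k_def saturated_def by (simp add: nn_integral_density ennreal_indicator nn_integral_add)
    also have "\<dots> = (\<integral>\<^sup>+x. indicator U x * ennreal (\<omega> (T x)) \<partial>?L)"
    proof (rule nn_integral_cong)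
      fix x assume x: "x \<in> space ?L"
      show "indicator U x * ennreal (dist_Rd d x (T x) powr p) + ennreal (- \<phi> x) = indicator U x * ennreal (\<omega> (T x))"
      proof (cases "x \<in> U")
        case True
        then have "0 \<le> - \<phi> x" "\<omega> (T x) = dist_Rd d x (T x) powr p + - \<phi> x"
          using contact[OF True] by (auto simp: U)
        then show ?thesis using True by (simp add: ennreal_plus[symmetric] del: ennreal_plus)
      qed (use x in \<open>auto simp: U ennreal_neg\<close>)
    qed
    also have "\<dots> = (\<integral>\<^sup>+x. ennreal (\<omega> (T x)) \<partial>saturated d U)"
      unfolding saturated_def by (simp add: nn_integral_density ennreal_indicator)
    also have "\<dots> = \<Omega>" unfolding \<Omega>_def \<mu>_def by (rule nn_integral_distr[symmetric]) measurable
    finally show ?thesis .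
  qed
  have c_fin: "c < \<infinity>" using \<Omega>_fin c_k[symmetric] by (simp add: less_top[symmetric])
  have cost_\<rho>: "transport_cost d p (saturated d U) \<mu> \<le> c"
  proof -
    have "distr (saturated d U) (borel_Rd d) (\<lambda>x. x) = saturated d U"
      by (rule distr_id2[OF \<rho>_borel[symmetric]])
    then show ?thesis
      using transport_cost_distr_le[OF id\<rho> T\<rho>, of p] by (simp add: c_def \<mu>_def)
  qed
  have AE_S: "AE y in \<mu>. y \<in> S"
    unfolding \<mu>_def using S sets.sets_into_space[OF S(1)]
    by (subst AE_distr_iff) (auto simp: Int_absorb1 Collect_conj_eq)
  note dual_le = transport_cost_dual_le[OF \<phi>b \<omega> S(1) AE_S dual B(2), folded \<Omega>_def]
  \<comment> \<open>The bathtub bound: no admissible density collects more than \<open>k\<close>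
    from the negative part of \<open>\<phi>\<close>.\<close>
  have neg_le: "(\<integral>\<^sup>+x. ennreal (- \<phi> x) \<partial>density ?L (\<lambda>x. ennreal (f x))) \<le> k"
    if f: "f \<in> borel_measurable ?L" "AE x in ?L. 0 \<le> f x \<and> f x \<le> (1::real)" for f
  proof -
    have "(\<integral>\<^sup>+x. ennreal (- \<phi> x) \<partial>density ?L (\<lambda>x. ennreal (f x))) = (\<integral>\<^sup>+x. ennreal (f x) * ennreal (- \<phi> x) \<partial>?L)"
      using f by (intro nn_integral_density) auto
    also have "\<dots> \<le> (\<integral>\<^sup>+x. 1 * ennreal (- \<phi> x) \<partial>?L)"
    proof (rule nn_integral_mono_AE)
      show "AE x in ?L. ennreal (f x) * ennreal (- \<phi> x) \<le> 1 * ennreal (- \<phi> x)"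
        using f(2) by eventually_elim (intro mult_right_mono, auto)
    qed
    finally show ?thesis by (simp add: k_def)
  qed
  have c_le: "c \<le> transport_cost d p \<sigma> \<mu>" if \<sigma>: "\<sigma> \<in> K_space d p" for \<sigma>
  proof -
    obtain f where f: "f \<in> borel_measurable ?L" "AE x in ?L. 0 \<le> f x \<and> f x \<le> (1::real)"
      "\<sigma> = density ?L (\<lambda>x. ennreal (f x))" using \<sigma> unfolding K_space_def by blast
    have "c + k \<le> (\<integral>\<^sup>+x. ennreal (\<phi> x) \<partial>\<sigma>) + \<Omega>" unfolding c_k by simp
    also have "\<dots> \<le> transport_cost d p \<sigma> \<mu> + (\<integral>\<^sup>+x. ennreal (- \<phi> x) \<partial>\<sigma>)" by (rule dual_le)
    also have "\<dots> \<le> transport_cost d p \<sigma> \<mu> + k" unfolding f(3) by (intro add_left_mono neg_le f)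
    finally have "c + k \<le> transport_cost d p \<sigma> \<mu> + k" .
    then show ?thesis using k_fin ennreal_add_left_cancel_le[of k c] by (auto simp: add.commute)
  qed
  \<comment> \<open>A competitor of cost at most \<open>c\<close> attains the bathtub bound, so its
    density is 1 almost everywhere on \<open>U\<close>. As \<open>U\<close> has volume 1, no mass is
    left outside.\<close>
  have unique: "\<sigma> = saturated d U" if \<sigma>: "\<sigma> \<in> K_space d p" "transport_cost d p \<sigma> \<mu> \<le> c" for \<sigma>
  proof -
    obtain f where f[measurable]: "f \<in> borel_measurable ?L" and f01: "AE x in ?L. 0 \<le> f x \<and> f x \<le> (1::real)"
      and \<sigma>f: "\<sigma> = density ?L (\<lambda>x. ennreal (f x))" using \<sigma> unfolding K_space_def by blast
    interpret \<sigma>: prob_space \<sigma> using \<sigma> by (simp add: K_space_def P_space_def)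
    have "c + k \<le> (\<integral>\<^sup>+x. ennreal (\<phi> x) \<partial>\<sigma>) + \<Omega>" unfolding c_k by simp
    also have "\<dots> \<le> transport_cost d p \<sigma> \<mu> + (\<integral>\<^sup>+x. ennreal (- \<phi> x) \<partial>\<sigma>)" by (rule dual_le)
    also have "\<dots> \<le> c + (\<integral>\<^sup>+x. ennreal (- \<phi> x) \<partial>\<sigma>)" using \<sigma>(2) by (rule add_right_mono)
    finally have "k \<le> (\<integral>\<^sup>+x. ennreal (- \<phi> x) \<partial>\<sigma>)"
      using c_fin by (auto simp: ennreal_add_left_cancel_le)
    also have "\<dots> = (\<integral>\<^sup>+x. ennreal (f x) * ennreal (- \<phi> x) \<partial>?L)"
      unfolding \<sigma>f by (rule nn_integral_density) measurable
    finally have k_le: "k \<le> (\<integral>\<^sup>+x. ennreal (f x) * ennreal (- \<phi> x) \<partial>?L)" .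
    have "(\<integral>\<^sup>+x. ennreal (- \<phi> x) - ennreal (f x) * ennreal (- \<phi> x) \<partial>?L) =
        k - (\<integral>\<^sup>+x. ennreal (f x) * ennreal (- \<phi> x) \<partial>?L)"
      unfolding k_def
    proof (rule nn_integral_diff)
      have le: "AE x in ?L. ennreal (f x) * ennreal (- \<phi> x) \<le> ennreal (- \<phi> x)"
        using f01
      proof eventually_elim
        case (elim x)
        then have "ennreal (f x) * ennreal (- \<phi> x) \<le> 1 * ennreal (- \<phi> x)" by (intro mult_right_mono) auto
        then show ?case by simp
      qed
      then show "AE x in ?L. ennreal (f x) * ennreal (- \<phi> x) \<le> ennreal (- \<phi> x)" .
      have "(\<integral>\<^sup>+x. ennreal (f x) * ennreal (- \<phi> x) \<partial>?L) \<le> k" unfolding k_def by (rule nn_integral_mono_AE[OF le])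
      then show "(\<integral>\<^sup>+x. ennreal (f x) * ennreal (- \<phi> x) \<partial>?L) \<noteq> \<infinity>" using k_fin by auto
    qed measurable
    also have "\<dots> = 0" using k_le k_fin by (simp add: diff_eq_0_iff_ennreal)
    finally have "AE x in ?L. ennreal (- \<phi> x) - ennreal (f x) * ennreal (- \<phi> x) = 0"
      by (subst (asm) nn_integral_0_iff_AE) auto
    with f01 have one: "AE x in ?L. x \<in> U \<longrightarrow> f x = 1"
    proof eventually_elim
      case (elim x)
      show ?case
      proof
        assume "x \<in> U"
        then have "\<phi> x < 0" by (simp add: U)
        have "ennreal (- \<phi> x) \<le> ennreal (f x) * ennreal (- \<phi> x)"
          using elim by (simp add: diff_eq_0_iff_ennreal)
        also have "\<dots> = ennreal (f x * - \<phi> x)"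
          by (rule ennreal_mult'[symmetric]) (use elim in simp)
        finally have "ennreal (- \<phi> x) \<le> ennreal (f x * - \<phi> x)" .
        moreover have "0 \<le> f x * - \<phi> x" using elim \<open>\<phi> x < 0\<close> by (intro mult_nonneg_nonneg) auto
        ultimately have "- \<phi> x \<le> f x * - \<phi> x" by (subst (asm) ennreal_le_iff)
        then have "1 \<le> f x" using \<open>\<phi> x < 0\<close> by (simp add: mult_le_cancel_right1)
        then show "f x = 1" using elim by simp
      qed
    qed
    have "(\<integral>\<^sup>+x. ennreal (f x) \<partial>?L) = emeasure \<sigma> (space \<sigma>)"
      unfolding \<sigma>f by (simp add: emeasure_density cong: nn_integral_cong)
    then have total: "(\<integral>\<^sup>+x. ennreal (f x) \<partial>?L) = 1" by (simp add: \<sigma>.emeasure_space_1)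
    have "(\<integral>\<^sup>+x. ennreal (f x) - indicator U x \<partial>?L) = (\<integral>\<^sup>+x. ennreal (f x) \<partial>?L) - (\<integral>\<^sup>+x. indicator U x \<partial>?L)"
    proof (rule nn_integral_diff)
      show "AE x in ?L. indicator U x \<le> ennreal (f x)" using one by eventually_elim (auto simp: indicator_def)
      show "(\<integral>\<^sup>+x. indicator U x \<partial>?L) \<noteq> \<infinity>" by (simp add: vol)
    qed measurable
    also have "\<dots> = 0" by (simp add: total vol)
    finally have "AE x in ?L. ennreal (f x) - indicator U x = 0"
      by (subst (asm) nn_integral_0_iff_AE) auto
    with f01 one have "AE x in ?L. ennreal (f x) = ennreal (indicator U x)"
      by eventually_elim (auto simp: indicator_def ennreal_eq_0_iff split: if_splits)
    then show ?thesis unfolding \<sigma>f saturated_def by (intro density_cong) auto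
  qed
  have "is_arg_min (\<lambda>\<sigma>. transport_cost d p \<sigma> \<mu>) (\<lambda>\<sigma>. \<sigma> \<in> K_space d p) \<sigma> \<longleftrightarrow> \<sigma> = saturated d U" for \<sigma>
  proof
    assume "is_arg_min (\<lambda>\<sigma>. transport_cost d p \<sigma> \<mu>) (\<lambda>\<sigma>. \<sigma> \<in> K_space d p) \<sigma>"
    then have "\<sigma> \<in> K_space d p" "transport_cost d p \<sigma> \<mu> \<le> transport_cost d p (saturated d U) \<mu>"
      using K by (auto simp: is_arg_min_linorder)
    then show "\<sigma> = saturated d U" using unique cost_\<rho> order_trans by blast
  next
    assume "\<sigma> = saturated d U"
    then show "is_arg_min (\<lambda>\<sigma>. transport_cost d p \<sigma> \<mu>) (\<lambda>\<sigma>. \<sigma> \<in> K_space d p) \<sigma>"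
      using K c_le cost_\<rho> by (auto simp: is_arg_min_linorder intro: order_trans)
  qed
  note am = this
  show ?thesis unfolding projection_def arg_min_def \<mu>_def[symmetric]
    by (rule some_equality) (simp_all only: am)
qed

section \<open>The union of two balls\<close>

lemma powr_le_tangent:
  fixes u y q :: real
  assumes "0 \<le> u" "0 < y" "0 < q" "q < 1"
  shows "u powr q \<le> y powr q + q * y powr (q - 1) * (u - y)"
proof (cases "u = 0")
  case True
  have "y powr q = y * y powr (q - 1)" using assms by (simp add: powr_mult_base)
  moreover have "q * (y * y powr (q - 1)) \<le> 1 * (y * y powr (q - 1))"
    using assms by (intro mult_right_mono) auto
  ultimately show ?thesis using True assms by (simp add: algebra_simps)
next
  case False
  \<comment> \<open>Weighted AM-GM; dividing by \<open>y powr (1 - q)\<close> produces the tangent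
    of \<open>u powr q\<close> at \<open>y\<close>.\<close>
  have "u powr q * y powr (1 - q) \<le> q * u + (1 - q) * y"
    using assms False by (intro Youngs_inequality_0) auto
  then have *: "u powr q * y powr (1 - q) * y powr (q - 1) \<le> (q * u + (1 - q) * y) * y powr (q - 1)"
    by (rule mult_right_mono) simp
  have "u powr q = u powr q * y powr (1 - q) * y powr (q - 1)"
    using assms by (simp add: mult.assoc powr_add[symmetric])
  also note *
  also have "(q * u + (1 - q) * y) * y powr (q - 1) = y * y powr (q - 1) + q * y powr (q - 1) * (u - y)"
    by (simp add: algebra_simps)
  also have "y * y powr (q - 1) = y powr q" using assms by (simp add: powr_mult_base)
  finally show ?thesis .
qed

text \<open>For a concave power, the increment over a fixed step decreases with the base point. This
  keeps the cell of the upper atom above the hyperplane \<open>x 0 = 0\<close>.\<close>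

lemma powr_diff_antimono:
  fixes u v D D' q :: real
  assumes "0 < u" "u \<le> v" "0 \<le> D" "D \<le> D'" "0 < q" "q < 1"
  shows "(v + D) powr q - v powr q \<le> (u + D') powr q - u powr q"
proof -
  have "(v + D) powr q - v powr q \<le> (u + D) powr q - u powr q"
  proof (rule DERIV_nonpos_imp_nonincreasing[OF assms(2), where f="\<lambda>t. (t + D) powr q - t powr q"])
    fix t assume t: "u \<le> t" "t \<le> v"
    have "((\<lambda>t. (t + D) powr q - t powr q) has_real_derivative q * (t + D) powr (q - 1) - q * t powr (q - 1)) (at t)"
      using t assms by (auto intro!: derivative_eq_intros)
    moreover have "(t + D) powr (q - 1) \<le> t powr (q - 1)"
      using t assms by (intro powr_mono2') auto
    ultimately show "\<exists>y. ((\<lambda>t. (t + D) powr q - t powr q) has_real_derivative y) (at t) \<and> y \<le> 0"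
      using assms(5) by (auto intro!: exI)
  qed
  also have "(u + D) powr q \<le> (u + D') powr q"
    using assms by (intro powr_mono2) auto
  finally show ?thesis by simp
qed

text \<open>Tangents at \<open>r\<close> and at \<open>u + e\<close> compare the two increments; the
  second slope is larger by a factor of at least \<open>z powr (q - 1)\<close>, and AM-GM bounds
  \<open>z powr (1 - q)\<close> linearly in \<open>z\<close>. So a base point smaller by the factor
  \<open>z\<close> compensates for a step \<open>e\<close> slightly shorter than \<open>D\<close>,
  which measures how far the interface rises.\<close>

lemma powr_increment_le:
  fixes r u D e z q :: real
  assumes "0 < r" "0 \<le> u" "0 < e" "0 < z" "z \<le> 1" "u + e \<le> z * r" "0 < q" "q < 1"
    and D: "(1 - (1 - q) * (1 - z)) * D \<le> e" "0 \<le> D"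
  shows "(r + D) powr q - r powr q \<le> (u + e) powr q - u powr q"
proof -
  have "z powr (1 - q) * 1 powr q \<le> (1 - q) * z + q * 1"
    using assms by (intro Youngs_inequality_0) auto
  then have "z powr (1 - q) \<le> 1 - (1 - q) * (1 - z)" by (simp add: algebra_simps)
  then have "z powr (1 - q) * D \<le> e" using D mult_right_mono order_trans by blast
  then have "z powr (1 - q) * D * (z * r) powr (q - 1) \<le> e * (z * r) powr (q - 1)"
    by (rule mult_right_mono) simp
  moreover have "z powr (1 - q) * D * (z * r) powr (q - 1) = D * r powr (q - 1)"
  proof -
    have "z powr (1 - q) * z powr (q - 1) = 1" using assms by (simp add: powr_add[symmetric])
    then show ?thesis using assms by (simp add: powr_mult)
  qed
  moreover have "(z * r) powr (q - 1) \<le> (u + e) powr (q - 1)"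
    using assms by (intro powr_mono2') auto
  then have "e * (z * r) powr (q - 1) \<le> e * (u + e) powr (q - 1)"
    using assms by (intro mult_left_mono) auto
  ultimately have *: "D * r powr (q - 1) \<le> e * (u + e) powr (q - 1)" by simp
  have "(r + D) powr q - r powr q \<le> q * (D * r powr (q - 1))"
    using powr_le_tangent[of "r + D" r q] assms by (simp add: algebra_simps)
  also have "\<dots> \<le> q * (e * (u + e) powr (q - 1))"
    using * assms by (intro mult_left_mono) auto
  also have "\<dots> \<le> (u + e) powr q - u powr q"
    using powr_le_tangent[of u "u + e" q] assms by (simp add: algebra_simps)
  finally show ?thesis .
qed

text \<open>
  The union of the ball of radius \<open>R\<close> around the origin and the ball of radius \<open>sqrt (R\<^sup>2 + s\<^sup>2)\<close> around
  the point at height \<open>s\<close> on the first axis; for \<open>s = 0\<close> it is a centered ball.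
\<close>

definition cap_union :: "nat \<Rightarrow> real \<Rightarrow> real \<Rightarrow> (nat \<Rightarrow> real) set" where
  "cap_union d R s = {x \<in> space (lborel_Rd d). sq_norm d x < R\<^sup>2 + 2 * s * max 0 (x 0)}"

section \<open>Volume of the union: dilation, finiteness, normalization, reflection\<close>

lemma measure_lborel_Rd_scale:
  assumes "\<And>i. i < d \<Longrightarrow> c i \<noteq> (0::real)" "A \<in> sets (lborel_Rd d)"
  shows "measure (lborel_Rd d) A = (\<Prod>i<d. \<bar>c i\<bar>) *
    measure (lborel_Rd d) {x \<in> space (lborel_Rd d). (\<lambda>i\<in>{..<d}. c i * x i) \<in> A}"
  unfolding measure_def by (simp add: emeasure_lborel_Rd_scale[OF assms] enn2real_mult prod_nonneg)

lemma sets_cap_union [measurable]: "0 < d \<Longrightarrow> cap_union d R s \<in> sets (lborel_Rd d)"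
  using measurable_component_Rd[of 0 d] unfolding cap_union_def by measurable

lemma scale_in_space: "(\<lambda>i\<in>{..<d}. c i * x i) \<in> space (lborel_Rd d)"
  by (simp add: space_PiM)

lemma sq_norm_scale: "sq_norm d (\<lambda>i\<in>{..<d}. c * x i) = c\<^sup>2 * sq_norm d x"
  by (simp add: sq_norm_def sum_distrib_left power_mult_distrib)

lemma measure_cap_union_scale:
  assumes d: "0 < d" and c: "0 < c"
  shows "measure (lborel_Rd d) (cap_union d (c * R) (c * s)) = c ^ d * measure (lborel_Rd d) (cap_union d R s)"
proof -
  have "{x \<in> space (lborel_Rd d). (\<lambda>i\<in>{..<d}. c * x i) \<in> cap_union d (c * R) (c * s)} = cap_union d R s"
  proof -
    have "sq_norm d (\<lambda>i\<in>{..<d}. c * x i) < (c * R)\<^sup>2 + 2 * (c * s) * max 0 (c * x 0)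
        \<longleftrightarrow> sq_norm d x < R\<^sup>2 + 2 * s * max 0 (x 0)" for x
    proof -
      have "(c * R)\<^sup>2 + 2 * (c * s) * max 0 (c * x 0) = c\<^sup>2 * (R\<^sup>2 + 2 * s * max 0 (x 0))"
        using c by (simp add: max_def zero_le_mult_iff power2_eq_square algebra_simps)
      then show ?thesis using c unfolding sq_norm_scale by simp
    qed
    then show ?thesis using d by (auto simp: cap_union_def scale_in_space space_PiM)
  qed
  note eq = this
  have "measure (lborel_Rd d) (cap_union d (c * R) (c * s)) = (\<Prod>i<d. \<bar>c\<bar>) *
      measure (lborel_Rd d) {x \<in> space (lborel_Rd d). (\<lambda>i\<in>{..<d}. c * x i) \<in> cap_union d (c * R) (c * s)}"
    using c d by (intro measure_lborel_Rd_scale) auto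
  then show ?thesis using c unfolding eq by simp
qed

lemma sq_norm_cap_union_le:
  assumes "0 < d" "0 \<le> s"
  shows "\<forall>x \<in> cap_union d R s. sq_norm d x \<le> (R\<^sup>2 + 2 * s + 1)\<^sup>2"
  using sq_norm_le_of_paraboloid[OF assms, of _ "R\<^sup>2"] by (simp add: cap_union_def)

lemma emeasure_cap_union_finite:
  assumes "0 < d" "0 \<le> s"
  shows "emeasure (lborel_Rd d) (cap_union d R s) < \<infinity>"
  using sq_norm_cap_union_le[OF assms]
  by (intro emeasure_lborel_Rd_bounded[where B="(R\<^sup>2 + 2 * s + 1)\<^sup>2"]) (auto simp: cap_union_def)

lemma measure_cap_union_pos:
  assumes d: "1 < d" and s: "0 \<le> s"
  shows "0 < measure (lborel_Rd d) (cap_union d 1 s)"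
proof -
  \<comment> \<open>A cube of half side \<open>1 / d\<close> lies in the open unit ball: the squared
    norm is at most \<open>d * (1 / d)\<^sup>2 = 1 / d < 1\<close>.\<close>
  let ?A = "Pi\<^sub>E {..<d} (\<lambda>_. {- (1 / real d) .. 1 / real d})"
  have "?A \<subseteq> cap_union d 1 s"
  proof
    fix x assume x: "x \<in> ?A"
    have "sq_norm d x \<le> (\<Sum>i<d. (1 / real d)\<^sup>2)"
      unfolding sq_norm_def
    proof (rule sum_mono)
      fix i assume "i \<in> {..<d}"
      then have "x i \<in> {- (1 / real d) .. 1 / real d}" using x by (auto simp: PiE_iff)
      then have "\<bar>x i\<bar> \<le> 1 / real d" by (intro abs_leI) (simp_all only: atLeastAtMost_iff, linarith+)
      then show "(x i)\<^sup>2 \<le> (1 / real d)\<^sup>2" by (metis abs_ge_zero power2_abs power_mono)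
    qed
    also have "\<dots> < 1" using d by (simp add: power2_eq_square field_simps)
    also have "1 \<le> 1\<^sup>2 + 2 * s * max 0 (x 0)" using s by simp
    finally show "x \<in> cap_union d 1 s" using x by (simp add: cap_union_def space_PiM PiE_iff)
  qed
  then have "emeasure (lborel_Rd d) ?A \<le> emeasure (lborel_Rd d) (cap_union d 1 s)"
    using d by (intro emeasure_mono) auto
  moreover have "emeasure (lborel_Rd d) ?A = (\<Prod>i<d. emeasure lborel {- (1 / real d) .. 1 / real d})"
    by (intro lborel_factors.emeasure_PiM) auto
  moreover have "0 < (\<Prod>i<d. emeasure lborel {- (1 / real d) .. 1 / real d})"
    using d by (simp add: emeasure_lborel_Icc_eq ennreal_power)
  ultimately have "0 < emeasure (lborel_Rd d) (cap_union d 1 s)" by simp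
  moreover have "emeasure (lborel_Rd d) (cap_union d 1 s) < \<infinity>"
    using emeasure_cap_union_finite[of d s 1] d s by simp
  ultimately show ?thesis by (simp add: measure_def enn2real_positive_iff)
qed


text \<open>With the height of the second center proportional to \<open>R\<close>, changing
  \<open>R\<close> is a dilation. The volume is then a positive constant times \<open>R ^ d\<close>
  and can be normalized.\<close>

lemma ex_cap_union_volume_1:
  assumes d: "1 < d" and s: "0 \<le> s"
  obtains R where "0 < R" "measure (lborel_Rd d) (cap_union d R (s * R)) = 1"
proof -
  define v where "v = measure (lborel_Rd d) (cap_union d 1 s)"
  define r where "r = root d (1 / v)"
  have v: "0 < v" unfolding v_def by (rule measure_cap_union_pos[OF assms])
  have r: "0 < r" using v d by (simp add: r_def)
  have "measure (lborel_Rd d) (cap_union d (r * 1) (r * s)) = r ^ d * v"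
    unfolding v_def using r d by (intro measure_cap_union_scale) auto
  also have "\<dots> = 1" using v d by (simp add: r_def)
  finally have "measure (lborel_Rd d) (cap_union d r (s * r)) = 1" by (simp add: mult.commute)
  with r show thesis by (rule that)
qed

lemma measure_mono_cap_union:
  assumes "A \<subseteq> cap_union d R s" "A \<in> sets (lborel_Rd d)" "0 < d" "0 \<le> s"
  shows "measure (lborel_Rd d) A \<le> measure (lborel_Rd d) (cap_union d R s)"
  using assms emeasure_cap_union_finite[of d s R]
  by (intro measure_mono_fmeasurable) (auto simp: fmeasurable_def)

text \<open>Reflection in \<open>x 0 = 0\<close> maps the lower part into the upper one, since the
  term \<open>2 * s * max 0 (x 0)\<close> only enlarges the set above the hyperplane.\<close>

lemma half_cap_union:
  assumes d: "0 < d" and s: "0 \<le> s"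
  shows "measure (lborel_Rd d) (cap_union d R s) \<le> 2 * measure (lborel_Rd d) {x \<in> cap_union d R s. 0 \<le> x 0}"
proof -
  let ?L = "lborel_Rd d" and ?U = "cap_union d R s"
  define c :: "nat \<Rightarrow> real" where "c i = (if i = 0 then - 1 else 1)" for i
  note [measurable] = measurable_component_Rd[OF d] sets_cap_union[OF d]
  have sub: "?U \<subseteq> space ?L" by (auto simp: cap_union_def)
  have Un: "{x \<in> ?U. x 0 < 0} \<union> {x \<in> ?U. 0 \<le> x 0} = ?U" by auto
  have P: "{x \<in> ?U. x 0 < 0} = ?U \<inter> {x \<in> space ?L. x 0 < 0}" "{x \<in> ?U. 0 \<le> x 0} = ?U \<inter> {x \<in> space ?L. 0 \<le> x 0}"
    using sub by auto
  have [measurable]: "{x \<in> ?U. x 0 < 0} \<in> sets ?L" "{x \<in> ?U. 0 \<le> x 0} \<in> sets ?L"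
    unfolding P by measurable
  have fin: "{x \<in> ?U. 0 \<le> x 0} \<in> fmeasurable ?L"
    using emeasure_cap_union_finite[OF d s, of R] emeasure_mono[of "{x \<in> ?U. 0 \<le> x 0}" ?U ?L]
    by (auto simp: fmeasurable_def intro: le_less_trans)
  have "measure ?L ?U \<le> measure ?L {x \<in> ?U. x 0 < 0} + measure ?L {x \<in> ?U. 0 \<le> x 0}"
    using measure_Un_le[of "{x \<in> ?U. x 0 < 0}" ?L "{x \<in> ?U. 0 \<le> x 0}"] unfolding Un by simp
  also have "measure ?L {x \<in> ?U. x 0 < 0} =
      (\<Prod>i<d. \<bar>c i\<bar>) * measure ?L {x \<in> space ?L. (\<lambda>i\<in>{..<d}. c i * x i) \<in> {x \<in> ?U. x 0 < 0}}"
    by (rule measure_lborel_Rd_scale) (auto simp: c_def)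
  also have "(\<Prod>i<d. \<bar>c i\<bar>) = 1" by (rule prod.neutral) (auto simp: c_def)
  also have "1 * measure ?L {x \<in> space ?L. (\<lambda>i\<in>{..<d}. c i * x i) \<in> {x \<in> ?U. x 0 < 0}} \<le> measure ?L {x \<in> ?U. 0 \<le> x 0}"
    unfolding mult_1
  proof (rule measure_mono_fmeasurable[OF _ _ fin])
    have [measurable]: "(\<lambda>x. \<lambda>i\<in>{..<d}. c i * x i) \<in> measurable ?L ?L"
      by (rule measurable_restrict) (auto intro!: borel_measurable_times measurable_component_Rd)
    show "{x \<in> space ?L. (\<lambda>i\<in>{..<d}. c i * x i) \<in> {x \<in> ?U. x 0 < 0}} \<in> sets ?L" by measurable
    show "{x \<in> space ?L. (\<lambda>i\<in>{..<d}. c i * x i) \<in> {x \<in> ?U. x 0 < 0}} \<subseteq> {x \<in> ?U. 0 \<le> x 0}"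
    proof clarify
      fix x assume x: "x \<in> space ?L" "(\<lambda>i\<in>{..<d}. c i * x i) \<in> ?U" "(\<lambda>i\<in>{..<d}. c i * x i) 0 < 0"
      have "sq_norm d (\<lambda>i\<in>{..<d}. c i * x i) = sq_norm d x"
        unfolding sq_norm_def by (rule sum.cong) (auto simp: c_def)
      moreover have "0 < x 0" using x(3) d by (simp add: c_def)
      moreover have "0 \<le> 2 * s * max 0 (x 0)" using s by simp
      ultimately show "x \<in> ?U \<and> 0 \<le> x 0"
        using x d by (auto simp: cap_union_def c_def)
    qed
  qed
  finally show ?thesis by simp
qed

section \<open>The two-atom measures and their projections\<close>

definition origin :: "nat \<Rightarrow> nat \<Rightarrow> real" where
  "origin d = (\<lambda>i\<in>{..<d}. 0)"

definition axis_point :: "nat \<Rightarrow> real \<Rightarrow> nat \<Rightarrow> real" where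
  "axis_point d s = (\<lambda>i\<in>{..<d}. if i = 0 then s else 0)"

text \<open>A Laguerre cell for the cost with exponent \<open>p\<close>:
  \<open>sq_norm d x - 2 * s * x 0 + s\<^sup>2\<close> is the squared distance to
  \<open>axis_point d s\<close>, and \<open>R\<^sup>2 + s\<^sup>2\<close> is the squared radius of
  its ball. Strictness assigns ties to the origin, so the cell is empty for
  \<open>s = 0\<close>.\<close>

definition atom_cell :: "nat \<Rightarrow> real \<Rightarrow> real \<Rightarrow> real \<Rightarrow> (nat \<Rightarrow> real) set" where
  "atom_cell d p R s = {x \<in> cap_union d R s.
     (sq_norm d x - 2 * s * x 0 + s\<^sup>2) powr (p/2) - (R\<^sup>2 + s\<^sup>2) powr (p/2) < sq_norm d x powr (p/2) - (R\<^sup>2) powr (p/2)}"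

definition atom_map :: "nat \<Rightarrow> real \<Rightarrow> real \<Rightarrow> real \<Rightarrow> (nat \<Rightarrow> real) \<Rightarrow> nat \<Rightarrow> real" where
  "atom_map d p R s x = (if x \<in> atom_cell d p R s then axis_point d s else origin d)"

text \<open>For \<open>s = 0\<close> this is the Dirac measure at the origin.\<close>

definition two_atoms :: "nat \<Rightarrow> real \<Rightarrow> real \<Rightarrow> real \<Rightarrow> (nat \<Rightarrow> real) measure" where
  "two_atoms d p R s = distr (saturated d (cap_union d R s)) (borel_Rd d) (atom_map d p R s)"

lemma saturated_bounded:
  assumes U: "U \<in> sets (lborel_Rd d)" "emeasure (lborel_Rd d) U = 1" "\<forall>x\<in>U. sq_norm d x \<le> B" and p: "0 \<le> p"
  shows "prob_space (saturated d U)" "sets (saturated d U) = sets (borel_Rd d)"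
    "AE x in saturated d U. x \<in> U" "AE x in saturated d U. sq_norm d x \<le> B" "saturated d U \<in> K_space d p"
    "saturated d U \<in> P_space d p"
proof -
  have m[measurable]: "U \<in> sets (lborel_Rd d)" by fact
  show pr: "prob_space (saturated d U)"
    using U by (intro prob_spaceI) (simp add: saturated_def emeasure_density ennreal_indicator cong: nn_integral_cong)
  show s: "sets (saturated d U) = sets (borel_Rd d)" by (simp add: saturated_def sets_lborel_Rd[symmetric])
  show AE_U: "AE x in saturated d U. x \<in> U" unfolding saturated_def by (subst AE_density) (auto simp: indicator_def)
  then show B: "AE x in saturated d U. sq_norm d x \<le> B" by eventually_elim (use U(3) in blast)
  show P: "saturated d U \<in> P_space d p" by (rule P_spaceI[OF pr s B p])
  show "saturated d U \<in> K_space d p"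
    unfolding K_space_def using P
    by (auto intro!: bexI[of _ "indicator U"] simp: saturated_def indicator_def)
qed

lemma origin_space: "origin d \<in> space (borel_Rd d)" and axis_point_space: "axis_point d s \<in> space (borel_Rd d)"
  by (simp_all add: origin_def axis_point_def space_PiM)

lemma singleton_sets_borel_Rd: "x \<in> space (borel_Rd d) \<Longrightarrow> {x} \<in> sets (borel_Rd d)"
proof -
  assume x: "x \<in> space (borel_Rd d)"
  then have "{x} = Pi\<^sub>E {..<d} (\<lambda>i. {x i})"
    by (intro PiE_singleton[symmetric]) (auto simp: space_PiM PiE_iff)
  also have "\<dots> \<in> sets (borel_Rd d)" by (intro sets_PiM_I_finite) auto
  finally show ?thesis .
qed

lemma sq_norm_diff_axis_point:
  assumes "0 < d"
  shows "sq_norm d (\<lambda>i. x i - axis_point d s i) = sq_norm d x - 2 * s * x 0 + s\<^sup>2"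
proof -
  have I: "{..<d} = insert 0 {1..<d}" using assms by auto
  have "sq_norm d (\<lambda>i. x i - axis_point d s i) = (\<Sum>i<d. (x i - (if i = 0 then s else 0))\<^sup>2)"
    unfolding sq_norm_def axis_point_def by (rule sum.cong) auto
  also have "\<dots> = sq_norm d x - 2 * s * x 0 + s\<^sup>2"
    unfolding sq_norm_def I by (simp add: power2_diff algebra_simps)
  finally show ?thesis .
qed

lemma sqrt_powr: "0 \<le> y \<Longrightarrow> sqrt y powr p = y powr (p / 2)"
  by (simp add: powr_half_sqrt[symmetric] powr_powr)

lemma dist_origin_powr: "dist_Rd d x (origin d) powr p = sq_norm d x powr (p / 2)"
proof -
  have "sq_norm d (\<lambda>i. x i - origin d i) = sq_norm d x"
    unfolding sq_norm_def origin_def by (rule sum.cong) auto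
  then show ?thesis by (simp add: dist_Rd_eq sqrt_powr sq_norm_nonneg)
qed

lemma dist_axis_point_powr:
  assumes "0 < d"
  shows "dist_Rd d x (axis_point d s) powr p = (sq_norm d x - 2 * s * x 0 + s\<^sup>2) powr (p / 2)"
  by (simp add: dist_Rd_eq sqrt_powr sq_norm_nonneg flip: sq_norm_diff_axis_point[OF assms])

lemma sq_norm_shift_nonneg: "0 < d \<Longrightarrow> 0 \<le> sq_norm d x - 2 * s * x 0 + s\<^sup>2"
  using sq_norm_nonneg[of d "\<lambda>i. x i - axis_point d s i"] by (simp add: sq_norm_diff_axis_point)

lemma sets_atom_cell [measurable]:
  assumes d: "0 < d"
  shows "atom_cell d p R s \<in> sets (lborel_Rd d)"
proof -
  note [measurable] = measurable_component_Rd[OF d] sets_cap_union[OF d]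
  have "atom_cell d p R s = cap_union d R s \<inter> {x \<in> space (lborel_Rd d).
     (sq_norm d x - 2 * s * x 0 + s\<^sup>2) powr (p/2) - (R\<^sup>2 + s\<^sup>2) powr (p/2) < sq_norm d x powr (p/2) - (R\<^sup>2) powr (p/2)}"
    by (auto simp: atom_cell_def cap_union_def)
  also have "\<dots> \<in> sets (lborel_Rd d)" by measurable
  finally show ?thesis .
qed

lemma measurable_atom_map:
  assumes d: "0 < d"
  shows "atom_map d p R s \<in> measurable (lborel_Rd d) (borel_Rd d)"
proof -
  note [measurable] = sets_atom_cell[OF d]
  have "(\<lambda>_. axis_point d s) \<in> measurable (lborel_Rd d) (borel_Rd d)" "(\<lambda>_. origin d) \<in> measurable (lborel_Rd d) (borel_Rd d)"
    using axis_point_space origin_space by auto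
  then show ?thesis unfolding atom_map_def by measurable
qed

text \<open>The potential is a minimum of one term per atom. The dual inequality bounds it by the
  term of the given atom, and contact holds because \<open>atom_map\<close> selects the smaller
  term.\<close>

lemma projection_two_atoms:
  assumes d: "0 < d" and p: "0 < p" and R: "0 < R" and s: "0 \<le> s"
    and vol: "emeasure (lborel_Rd d) (cap_union d R s) = 1"
  shows "projection d p (two_atoms d p R s) = saturated d (cap_union d R s)"
  unfolding two_atoms_def
proof (rule projection_eqI)
  let ?L = "lborel_Rd d"
  let ?h0 = "(R\<^sup>2) powr (p/2)" and ?h1 = "(R\<^sup>2 + s\<^sup>2) powr (p/2)"
  define N where "N x = sq_norm d x - 2 * s * x 0 + s\<^sup>2" for x
  define \<phi> where "\<phi> x = min (sq_norm d x powr (p/2) - ?h0) (N x powr (p/2) - ?h1)" for x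
  \<comment> \<open>For \<open>s = 0\<close> the two atoms coincide, and so do \<open>?h0\<close>
    and \<open>?h1\<close>.\<close>
  define \<omega> where "\<omega> y = (if y \<in> {origin d} then ?h0 else ?h1)" for y
  note [measurable] = measurable_component_Rd[OF d]
  have N: "0 \<le> N x" for x using sq_norm_shift_nonneg[OF d] by (simp add: N_def)
  have powr_less_iff: "a powr (p/2) < b powr (p/2) \<longleftrightarrow> a < b" if "0 \<le> a" "0 \<le> b" for a b :: real
    using powr_less_mono2[of "p/2" a b] powr_mono2[of "p/2" b a] that p by (cases "a < b") auto
  have [measurable]: "N \<in> borel_measurable ?L" unfolding N_def[abs_def] by measurable
  show "\<phi> \<in> borel_measurable ?L" unfolding \<phi>_def[abs_def] by measurable
  have [measurable]: "{origin d} \<in> sets (borel_Rd d)" by (rule singleton_sets_borel_Rd[OF origin_space])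
  show "\<omega> \<in> borel_measurable (borel_Rd d)" unfolding \<omega>_def[abs_def] by measurable
  have "\<phi> x < 0 \<longleftrightarrow> sq_norm d x < R\<^sup>2 \<or> N x < R\<^sup>2 + s\<^sup>2" for x
    using powr_less_iff[OF sq_norm_nonneg[of d x], of "R\<^sup>2"] powr_less_iff[OF N[of x], of "R\<^sup>2 + s\<^sup>2"]
    by (auto simp: \<phi>_def min_less_iff_disj)
  \<comment> \<open>The second condition means \<open>sq_norm d x < R\<^sup>2 + 2 * s * x 0\<close>,
    so it is the weaker one above the hyperplane \<open>x 0 = 0\<close> and the stronger one
    below.\<close>
  moreover have "sq_norm d x < R\<^sup>2 \<or> N x < R\<^sup>2 + s\<^sup>2 \<longleftrightarrow> sq_norm d x < R\<^sup>2 + 2 * s * max 0 (x 0)" for x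
  proof (cases "0 \<le> x 0")
    case True
    then have "0 \<le> 2 * s * x 0" using s by simp
    then show ?thesis using True by (auto simp: N_def max_def)
  next
    case False
    then have "2 * s * x 0 \<le> 0" using s by (intro mult_nonneg_nonpos) auto
    then show ?thesis using False by (auto simp: N_def max_def)
  qed
  ultimately have \<phi>_neg: "\<phi> x < 0 \<longleftrightarrow> sq_norm d x < R\<^sup>2 + 2 * s * max 0 (x 0)" for x by simp
  then show "cap_union d R s = {x \<in> space ?L. \<phi> x < 0}" by (simp add: cap_union_def)
  show "emeasure ?L (cap_union d R s) = 1" by fact
  show "atom_map d p R s \<in> measurable ?L (borel_Rd d)" by (rule measurable_atom_map[OF d])
  show "{origin d, axis_point d s} \<in> sets (borel_Rd d)"
    by (rule sets.insert_in_sets[OF singleton_sets_borel_Rd[OF origin_space] singleton_sets_borel_Rd[OF axis_point_space]])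
  show "atom_map d p R s x \<in> {origin d, axis_point d s}" for x by (simp add: atom_map_def)
  have s0: "s = 0" if "axis_point d s = origin d"
    using fun_cong[OF that, of 0] d by (simp add: axis_point_def origin_def)
  show "\<phi> x + \<omega> y \<le> dist_Rd d x y powr p" if "y \<in> {origin d, axis_point d s}" for x y
  proof (cases "y = origin d")
    case True
    then show ?thesis by (auto simp: dist_origin_powr \<omega>_def \<phi>_def)
  next
    case False
    then have "y = axis_point d s" using that by simp
    then show ?thesis using False by (auto simp: dist_axis_point_powr[OF d] \<omega>_def \<phi>_def N_def)
  qed
  show "\<phi> x + \<omega> (atom_map d p R s x) = dist_Rd d x (atom_map d p R s x) powr p" if x: "x \<in> cap_union d R s" for x
  proof (cases "x \<in> atom_cell d p R s")
    case True
    then have lt: "N x powr (p/2) - ?h1 < sq_norm d x powr (p/2) - ?h0" by (simp add: atom_cell_def N_def)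
    have "axis_point d s \<noteq> origin d"
    proof
      assume "axis_point d s = origin d"
      then have "s = 0" by (rule s0)
      then show False using lt by (simp add: N_def)
    qed
    then show ?thesis using True lt
      by (simp add: atom_map_def \<omega>_def \<phi>_def dist_axis_point_powr[OF d] N_def[symmetric])
  next
    case False
    then show ?thesis using x
      by (auto simp: atom_map_def \<omega>_def \<phi>_def dist_origin_powr atom_cell_def N_def)
  qed
  show "- (?h0 + ?h1) \<le> \<phi> x" for x
  proof -
    have "0 \<le> sq_norm d x powr (p/2)" "0 \<le> N x powr (p/2)" "0 \<le> ?h0" "0 \<le> ?h1" by (rule powr_ge_zero)+
    then show ?thesis unfolding \<phi>_def min_def by (auto simp del: powr_ge_zero)
  qed
  show "0 \<le> \<omega> y" "\<omega> y \<le> ?h0 + ?h1" for y by (simp_all add: \<omega>_def)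
  show "saturated d (cap_union d R s) \<in> K_space d p"
    using p by (intro saturated_bounded(5)[OF sets_cap_union[OF d] vol sq_norm_cap_union_le[OF d s]]) auto
qed

section \<open>Barycenters and costs before and after projecting\<close>

lemma emeasure_cap_union_eq_1:
  assumes "0 < d" "0 \<le> s" "measure (lborel_Rd d) (cap_union d R s) = 1"
  shows "emeasure (lborel_Rd d) (cap_union d R s) = 1"
  using emeasure_cap_union_finite[OF assms(1,2), of R] assms(3) emeasure_eq_ennreal_measure[of "lborel_Rd d" "cap_union d R s"]
  by (simp add: top.not_eq_extremum)

lemma measure_saturated:
  assumes "0 < d" "A \<in> sets (lborel_Rd d)" "A \<subseteq> cap_union d R s"
  shows "measure (saturated d (cap_union d R s)) A = measure (lborel_Rd d) A"
proof -
  note [measurable] = sets_cap_union[OF assms(1)] assms(2)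
  have "emeasure (saturated d (cap_union d R s)) A = (\<integral>\<^sup>+x. ennreal (indicator (cap_union d R s) x) * indicator A x \<partial>lborel_Rd d)"
    unfolding saturated_def by (rule emeasure_density) measurable
  also have "\<dots> = (\<integral>\<^sup>+x. indicator A x \<partial>lborel_Rd d)"
    using assms(3) by (intro nn_integral_cong) (auto simp: indicator_def)
  finally show ?thesis by (simp add: measure_def)
qed

lemma mean_saturated:
  assumes d: "0 < d" and s: "0 \<le> s" and vol: "measure (lborel_Rd d) (cap_union d R s) = 1"
  shows "integrable (saturated d (cap_union d R s)) (\<lambda>x. x 0)"
    "(\<integral>x. x 0 \<partial>saturated d (cap_union d R s)) = s * measure (lborel_Rd d) {x \<in> cap_union d R s. 0 \<le> x 0}"
proof -
  let ?L = "lborel_Rd d" and ?U = "cap_union d R s"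
  let ?H = "{x \<in> ?U. 0 \<le> x 0}"
  note [measurable] = measurable_component_Rd[OF d] sets_cap_union[OF d]
  have H_eq: "?H = ?U \<inter> {x \<in> space ?L. 0 \<le> x 0}" by (auto simp: cap_union_def)
  have H: "?H \<in> sets ?L" unfolding H_eq by measurable
  have fin: "emeasure ?L ?H < \<infinity>"
    using emeasure_cap_union_finite[OF d s, of R] emeasure_mono[of ?H ?U ?L] by (auto intro: le_less_trans)
  let ?F = "\<lambda>x. indicator ?U x * (x 0 - (if 0 \<le> x 0 then s else 0)) :: real"
  have F_eq: "indicator {x. sq_norm d x < R\<^sup>2 + 2 * s * max 0 (x 0)} x * (x 0 - (if 0 \<le> x 0 then s else 0)) = ?F x"
    if "x \<in> space ?L" for x
    using that by (simp add: cap_union_def indicator_def)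
  have intF: "integrable ?L ?F"
    using integral_paraboloid_eq_0(2)[OF d s, of "R\<^sup>2"] F_eq by (subst (asm) Bochner_Integration.integrable_cong[OF refl]) auto
  have F0: "integral\<^sup>L ?L ?F = 0"
    using integral_paraboloid_eq_0(1)[OF d s, of "R\<^sup>2"] F_eq by (subst (asm) Bochner_Integration.integral_cong[OF refl]) auto
  have intH: "integrable ?L (\<lambda>x. s * indicator ?H x)" using H fin by (intro integrable_mult_right integrable_real_indicator)
  have split: "indicator ?U x *\<^sub>R x 0 = ?F x + s * indicator ?H x" for x
    by (auto simp: indicator_def)
  have "integrable ?L (\<lambda>x. indicator ?U x *\<^sub>R x 0)"
    unfolding split using intF intH by (rule Bochner_Integration.integrable_add)
  then show "integrable (saturated d ?U) (\<lambda>x. x 0)"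
    unfolding saturated_def by (subst integrable_density) auto
  have "(\<integral>x. x 0 \<partial>saturated d ?U) = (\<integral>x. indicator ?U x *\<^sub>R x 0 \<partial>?L)"
    unfolding saturated_def by (subst integral_density) auto
  also have "\<dots> = integral\<^sup>L ?L ?F + (\<integral>x. s * indicator ?H x \<partial>?L)"
    unfolding split using intF intH by (rule Bochner_Integration.integral_add)
  also have "\<dots> = s * measure ?L ?H" using H fin by (simp add: F0)
  finally show "(\<integral>x. x 0 \<partial>saturated d ?U) = s * measure ?L ?H" .
qed

lemma two_atoms_P_space:
  assumes d: "0 < d" and p: "0 \<le> p" and s: "0 \<le> s" and vol: "emeasure (lborel_Rd d) (cap_union d R s) = 1"
  shows "two_atoms d p R s \<in> P_space d p"
proof (rule P_spaceI[OF _ _ _ p])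
  let ?\<rho> = "saturated d (cap_union d R s)"
  interpret \<rho>: prob_space ?\<rho>
    using sets_cap_union[OF d] vol sq_norm_cap_union_le[OF d s] p by (rule saturated_bounded(1))
  have T: "atom_map d p R s \<in> measurable ?\<rho> (borel_Rd d)"
    using measurable_atom_map[OF d] by (simp add: saturated_def)
  show "prob_space (two_atoms d p R s)" unfolding two_atoms_def by (rule \<rho>.prob_space_distr[OF T])
  show "sets (two_atoms d p R s) = sets (borel_Rd d)" by (simp add: two_atoms_def)
  have [measurable]: "sq_norm d \<in> borel_measurable (borel_Rd d)" by (simp add: measurable_borel_Rd_iff)
  let ?B = "max (sq_norm d (axis_point d s)) (sq_norm d (origin d))"
  have "{x \<in> space (borel_Rd d). sq_norm d x \<le> ?B} \<in> sets (borel_Rd d)" by measurable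
  then show "AE x in two_atoms d p R s. sq_norm d x \<le> ?B"
    unfolding two_atoms_def by (subst AE_distr_iff[OF T]) (auto simp: atom_map_def)
qed

text \<open>Moving the upper atom to the origin, over distance \<open>s\<close>, costs
  \<open>s powr p\<close> times its mass; the other atom stays.\<close>

lemma transport_cost_two_atoms_le:
  assumes d: "0 < d" and p: "0 < p" and s: "0 \<le> s"
    and vol: "emeasure (lborel_Rd d) (cap_union d R s) = 1" "emeasure (lborel_Rd d) (cap_union d R' 0) = 1"
  shows "transport_cost d p (two_atoms d p R s) (two_atoms d p R' 0)
    \<le> ennreal (s powr p * measure (lborel_Rd d) (atom_cell d p R s))"
proof -
  let ?\<rho> = "saturated d (cap_union d R s)" and ?\<rho>' = "saturated d (cap_union d R' 0)"
  let ?T = "atom_map d p R s" and ?A = "atom_cell d p R s"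
  interpret \<rho>: prob_space ?\<rho>
    using sets_cap_union[OF d] vol(1) sq_norm_cap_union_le[OF d s] less_imp_le[OF p] by (rule saturated_bounded(1))
  interpret \<rho>': prob_space ?\<rho>'
    using sets_cap_union[OF d] vol(2) sq_norm_cap_union_le[OF d order_refl] less_imp_le[OF p] by (rule saturated_bounded(1))
  have "atom_map d p R' 0 = (\<lambda>_. origin d)"
    by (auto simp: atom_map_def axis_point_def origin_def)
  \<comment> \<open>The Dirac measure at the origin is also the image of \<open>?\<rho>\<close>
    under a constant map, which puts both measures over one source.\<close>
  then have eq: "two_atoms d p R' 0 = distr ?\<rho> (borel_Rd d) (\<lambda>_. origin d)"
    unfolding two_atoms_def by (simp add: \<rho>.distr_const \<rho>'.distr_const origin_space)
  have T: "?T \<in> measurable ?\<rho> (borel_Rd d)" "(\<lambda>_. origin d) \<in> measurable ?\<rho> (borel_Rd d)"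
    using measurable_atom_map[OF d] origin_space by (simp_all add: saturated_def)
  have A: "?A \<in> sets ?\<rho>" using sets_atom_cell[OF d] by (simp add: saturated_def)
  have sub: "?A \<subseteq> cap_union d R s" by (auto simp: atom_cell_def)
  have cost: "dist_Rd d (?T x) (origin d) powr p = s powr p * indicator ?A x" for x
  proof -
    have "sq_norm d (axis_point d s) = s\<^sup>2"
    proof -
      have "{..<d} = insert 0 {1..<d}" using d by auto
      then show ?thesis by (simp add: sq_norm_def axis_point_def)
    qed
    moreover have "sq_norm d (origin d) = 0" by (simp add: sq_norm_def origin_def)
    moreover have "(s\<^sup>2) powr (p / 2) = s powr p"
      using s sqrt_powr[of "s\<^sup>2" p] by simp
    ultimately show ?thesis by (auto simp: dist_origin_powr atom_map_def indicator_def)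
  qed
  have "transport_cost d p (two_atoms d p R s) (two_atoms d p R' 0) \<le> (\<integral>\<^sup>+x. ennreal (dist_Rd d (?T x) (origin d) powr p) \<partial>?\<rho>)"
    using transport_cost_distr_le[OF T, of p] unfolding eq unfolding two_atoms_def .
  also have "\<dots> = (\<integral>\<^sup>+x. ennreal (s powr p) * indicator ?A x \<partial>?\<rho>)"
    unfolding cost by (intro nn_integral_cong) (auto simp: indicator_def)
  also have "\<dots> = ennreal (s powr p) * emeasure ?\<rho> ?A"
    using A by (rule nn_integral_cmult_indicator)
  also have "\<dots> = ennreal (s powr p * measure (lborel_Rd d) ?A)"
    using measure_saturated[OF d sets_atom_cell[OF d] sub]
    by (simp add: \<rho>.emeasure_eq_measure ennreal_mult)
  finally show ?thesis .
qed

text \<open>Before projecting the cost is at most \<open>s powr p * ?m\<close>. Afterwards it is at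
  least \<open>(s * ?h) powr p\<close>, since the centered ball has barycenter height 0.\<close>

lemma wasserstein_lt_of_volumes:
  assumes d: "0 < d" and p: "1 < p" and s: "0 < s" and R: "0 < R" "0 < R'"
    and vol: "measure (lborel_Rd d) (cap_union d R s) = 1" "measure (lborel_Rd d) (cap_union d R' 0) = 1"
    and lt: "measure (lborel_Rd d) (atom_cell d p R s) < measure (lborel_Rd d) {x \<in> cap_union d R s. 0 \<le> x 0} powr p"
      (is "?m < ?h powr p")
  shows "wasserstein d p (two_atoms d p R s) (two_atoms d p R' 0)
    < wasserstein d p (projection d p (two_atoms d p R s)) (projection d p (two_atoms d p R' 0))"
proof -
  let ?\<rho> = "saturated d (cap_union d R s)" and ?\<rho>' = "saturated d (cap_union d R' 0)"
  have s0: "0 \<le> s" and p0: "0 < p" "0 \<le> p" using s p by auto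
  note vol' = emeasure_cap_union_eq_1[OF d s0 vol(1)] emeasure_cap_union_eq_1[OF d order_refl vol(2)]
  note \<rho> = saturated_bounded[OF sets_cap_union[OF d] vol'(1) sq_norm_cap_union_le[OF d s0] p0(2)]
  note \<rho>' = saturated_bounded[OF sets_cap_union[OF d] vol'(2) sq_norm_cap_union_le[OF d order_refl] p0(2)]
  have proj: "projection d p (two_atoms d p R s) = ?\<rho>" "projection d p (two_atoms d p R' 0) = ?\<rho>'"
    using projection_two_atoms d p0 R s0 vol' by auto
  have h: "0 < ?h"
    using half_cap_union[OF d s0, of R] vol(1) by simp
  have "ennreal ((s * ?h) powr p) \<le> transport_cost d p ?\<rho> ?\<rho>'"
  proof (rule transport_cost_ge_mean_diff[OF \<rho>(1) d])
    show "s * ?h \<le> (\<integral>x. x 0 \<partial>?\<rho>) - (\<integral>x. x 0 \<partial>?\<rho>')"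
      using mean_saturated(2)[OF d s0 vol(1)] mean_saturated(2)[OF d order_refl vol(2)] by simp
  qed (use p s h mean_saturated(1)[OF d s0 vol(1)] mean_saturated(1)[OF d order_refl vol(2)] in auto)
  moreover have "transport_cost d p ?\<rho> ?\<rho>' < \<infinity>"
  proof (rule transport_cost_finite[OF \<rho>(1) \<rho>'(1) \<rho>(2) \<rho>'(2) _ _ p0(2)])
    let ?B = "max ((R\<^sup>2 + 2 * s + 1)\<^sup>2) ((R'\<^sup>2 + 2 * 0 + 1)\<^sup>2)"
    show "AE x in ?\<rho>. sq_norm d x \<le> ?B" using \<rho>(4) by eventually_elim simp
    show "AE x in ?\<rho>'. sq_norm d x \<le> ?B" using \<rho>'(4) by eventually_elim simp
  qed
  ultimately have lower: "(s * ?h) powr p \<le> enn2real (transport_cost d p ?\<rho> ?\<rho>')"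
    using enn2real_mono[of "ennreal ((s * ?h) powr p)" "transport_cost d p ?\<rho> ?\<rho>'"] by simp
  have "enn2real (transport_cost d p (two_atoms d p R s) (two_atoms d p R' 0)) \<le> s powr p * ?m"
    using transport_cost_two_atoms_le[OF d p0(1) s0 vol'] by (intro enn2real_leI) auto
  also have "\<dots> < s powr p * ?h powr p" using lt s by simp
  also have "\<dots> = (s * ?h) powr p" using s h by (simp add: powr_mult)
  also note lower
  finally show ?thesis
    unfolding wasserstein_def proj using p by (intro powr_less_mono2) auto
qed

section \<open>Volume of the displaced interface\<close>

text \<open>Points of the union have norm below \<open>R + 2 * s = (1 + 1 / d) * R\<close>, and
  \<open>(1 + 1 / d) ^ d \<le> exp 1 \<le> 3\<close>. The ball thus keeps a share of the volume
  independent of the dimension.\<close>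

lemma measure_ball_ge:
  assumes d: "0 < d" and R: "0 < R" and vol: "measure (lborel_Rd d) (cap_union d R (R / (2 * real d))) = 1"
  shows "1 / 3 \<le> measure (lborel_Rd d) (cap_union d R 0)"
proof -
  define s where "s = R / (2 * real d)"
  have s: "0 < s" using d R by (simp add: s_def)
  have "cap_union d R s \<subseteq> cap_union d (R + 2 * s) 0"
  proof
    fix x assume x: "x \<in> cap_union d R s"
    define n where "n = sqrt (sq_norm d x)"
    have n: "0 \<le> n" "sq_norm d x = n\<^sup>2" by (simp_all add: n_def sq_norm_nonneg)
    have "max 0 (x 0) \<le> n" using abs_component_le[OF d, of x] n(1) by (auto simp: n_def)
    then have "2 * s * max 0 (x 0) \<le> 2 * s * n" using s by (intro mult_left_mono) auto
    moreover have "n\<^sup>2 < R\<^sup>2 + 2 * s * max 0 (x 0)" using x by (simp add: cap_union_def n(2))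
    ultimately have lt: "n\<^sup>2 < R\<^sup>2 + 2 * s * n" by linarith
    have "n < R + 2 * s"
    proof (rule ccontr)
      assume "\<not> ?thesis"
      then have "R * R \<le> (n - 2 * s) * n" using R s by (intro mult_mono) auto
      then show False using lt by (simp add: power2_eq_square algebra_simps)
    qed
    then have "n\<^sup>2 < (R + 2 * s)\<^sup>2" using n(1) by (intro power_strict_mono) auto
    then show "x \<in> cap_union d (R + 2 * s) 0" using x n(2) by (simp add: cap_union_def)
  qed
  then have "1 \<le> measure (lborel_Rd d) (cap_union d (R + 2 * s) 0)"
    using measure_mono_cap_union[of "cap_union d R s" d "R + 2 * s" 0] d vol by (simp add: sets_cap_union s_def)
  also have "R + 2 * s = (1 + 1 / real d) * R" using d by (simp add: s_def field_simps)
  also have "measure (lborel_Rd d) (cap_union d ((1 + 1 / real d) * R) 0)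
      = (1 + 1 / real d) ^ d * measure (lborel_Rd d) (cap_union d R 0)"
    using measure_cap_union_scale[of d "1 + 1 / real d" R 0] d by (simp add: add_pos_pos)
  also have "\<dots> \<le> exp 1 * measure (lborel_Rd d) (cap_union d R 0)"
    using exp_ge_one_plus_x_over_n_power_n[of d 1] d by (intro mult_right_mono) auto
  also have "\<dots> \<le> 3 * measure (lborel_Rd d) (cap_union d R 0)"
    using exp_le by (intro mult_right_mono) auto
  finally show ?thesis by simp
qed

text \<open>For \<open>x 0 < 0\<close> the base \<open>sq_norm d x\<close> is at most
  \<open>R\<^sup>2\<close> and the step \<open>s\<^sup>2 - 2 * s * x 0\<close> is at least
  \<open>s\<^sup>2\<close>. Concavity then gives the reverse of the inequality that defines the
  cell.\<close>

lemma atom_cell_nonneg: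
  assumes d: "0 < d" and s: "0 \<le> s" and q: "0 < p" "p < 2" and x: "x \<in> atom_cell d p R s"
  shows "0 \<le> x 0"
proof (rule ccontr)
  assume neg: "\<not> 0 \<le> x 0"
  show False
  proof -
    have "sq_norm d x \<noteq> 0" using abs_component_le[OF d, of x] neg by auto
    then have "0 < sq_norm d x" "sq_norm d x \<le> R\<^sup>2"
      using sq_norm_nonneg[of d x] x neg by (auto simp: atom_cell_def cap_union_def less_le)
    moreover have "2 * s * x 0 \<le> 0" using s neg by (intro mult_nonneg_nonpos) auto
    ultimately have "(R\<^sup>2 + s\<^sup>2) powr (p/2) - R\<^sup>2 powr (p/2)
        \<le> (sq_norm d x + (s\<^sup>2 - 2 * s * x 0)) powr (p/2) - sq_norm d x powr (p/2)"
      using q by (intro powr_diff_antimono) auto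
    then show False using x by (simp add: atom_cell_def algebra_simps)
  qed
qed

text \<open>A thin piece \<open>Q\<close> of the upper half lies outside the cell. A half ball of
  volume at least 1/12 is flattened by a factor of at most \<open>32 * (real d)\<^sup>2\<close>,
  whence \<open>384 = 12 * 32\<close>.\<close>

lemma atom_cell_volume:
  assumes d: "1 < d" and p: "1 < p" "p \<le> 3/2" and R: "0 < R"
    and vol: "measure (lborel_Rd d) (cap_union d R (R / (2 * real d))) = 1"
  shows "measure (lborel_Rd d) (atom_cell d p R (R / (2 * real d))) + 1 / (384 * (real d)\<^sup>2)
    \<le> measure (lborel_Rd d) {x \<in> cap_union d R (R / (2 * real d)). 0 \<le> x 0}"
proof -
  let ?L = "lborel_Rd d"
  define s where "s = R / (2 * real d)"
  \<comment> \<open>Bernoulli gives \<open>k ^ d \<ge> 1/2\<close>, while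
    \<open>(k * R)\<^sup>2 + s\<^sup>2\<close> still stays below \<open>R\<^sup>2\<close> by a
    margin of order \<open>R\<^sup>2 / d\<close>. The factor \<open>l\<close> is chosen so that
    \<open>k * R / l = s / (16 * d)\<close>.\<close>
  define k where "k = 1 - 1 / (2 * real d)"
  define l where "l = 32 * (real d)\<^sup>2 * k"
  define c where "c i = (if i = 0 then l else 1)" for i :: nat
  define B where "B = {z \<in> cap_union d (k * R) 0. 0 \<le> z 0}"
  \<comment> \<open>\<open>Q\<close> is a half ball of radius \<open>k R\<close>, flattened by the factor \<open>l\<close> into the slab \<open>x 0 \<le> s / (16 d)\<close>.\<close>
  define Q where "Q = {x \<in> space ?L. (\<lambda>i\<in>{..<d}. c i * x i) \<in> B}"
  define H where "H = {x \<in> cap_union d R s. 0 \<le> x 0}"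
  have d0: "0 < d" using d by simp
  have rd: "2 \<le> real d" using d by simp
  note [measurable] = measurable_component_Rd[OF d0] sets_cap_union[OF d0] sets_atom_cell[OF d0]
  have s: "0 < s" using R d by (simp add: s_def)
  have k: "3/4 \<le> k" "k < 1" using rd by (auto simp: k_def field_simps)
  have l: "1 \<le> l"
  proof -
    have "2\<^sup>2 * (3/4) \<le> (real d)\<^sup>2 * k" using rd k by (intro mult_mono power_mono) auto
    then show ?thesis by (simp add: l_def)
  qed
  have B: "B \<in> sets ?L"
  proof -
    have "B = cap_union d (k * R) 0 \<inter> {x \<in> space ?L. 0 \<le> x 0}" by (auto simp: B_def cap_union_def)
    then show ?thesis by simp
  qed
  have H: "H \<in> sets ?L"
  proof -
    have "H = cap_union d R s \<inter> {x \<in> space ?L. 0 \<le> x 0}" by (auto simp: H_def cap_union_def)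
    then show ?thesis by simp
  qed
  have T[measurable]: "(\<lambda>x. \<lambda>i\<in>{..<d}. c i * x i) \<in> measurable ?L ?L"
    by (rule measurable_restrict) (auto intro!: borel_measurable_times measurable_component_Rd)
  have Q: "Q \<in> sets ?L" using measurable_sets[OF T B] by (simp add: Q_def vimage_def Int_def conj_commute)
  have Q_point: "0 \<le> x 0 \<and> x 0 \<le> s / (16 * real d) \<and> sq_norm d x \<le> (k * R)\<^sup>2" if "x \<in> Q" for x
  proof -
    let ?z = "\<lambda>i\<in>{..<d}. c i * x i"
    have z: "?z \<in> B" using that by (simp add: Q_def)
    have z0: "?z 0 = l * x 0" using d by (simp add: c_def)
    have x0: "0 \<le> x 0" using z z0 l by (simp add: B_def zero_le_mult_iff)
    have lt: "sq_norm d ?z < (k * R)\<^sup>2" using z by (simp add: B_def cap_union_def)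
    have "sqrt (sq_norm d ?z) \<le> k * R"
      using lt k R by (intro real_le_lsqrt) auto
    then have "l * x 0 \<le> k * R" using abs_component_le[OF d0, of ?z] x0 l unfolding z0 by linarith
    moreover have "k * R = l * (s / (16 * real d))"
      using d by (simp add: l_def s_def field_simps power2_eq_square)
    ultimately have "l * x 0 \<le> l * (s / (16 * real d))" by linarith
    then have "x 0 \<le> s / (16 * real d)" by (rule mult_left_le_imp_le) (use l in simp)
    moreover have "sq_norm d x \<le> sq_norm d ?z"
      unfolding sq_norm_def
    proof (rule sum_mono)
      fix i assume "i \<in> {..<d}"
      moreover have "(x i)\<^sup>2 \<le> (c i * x i)\<^sup>2"
        using l mult_right_mono[of "1\<^sup>2" "(c i)\<^sup>2" "(x i)\<^sup>2"] power_mono[of 1 "c i" 2]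
        by (simp add: power_mult_distrib c_def)
      ultimately show "(x i)\<^sup>2 \<le> (?z i)\<^sup>2" by simp
    qed
    ultimately show ?thesis using x0 lt by simp
  qed
  have sub1: "atom_cell d p R s \<subseteq> H"
    using atom_cell_nonneg[of d s p _ R] d0 s p by (auto simp: H_def atom_cell_def)
  have sub2: "Q \<subseteq> H"
  proof
    fix x assume x: "x \<in> Q"
    have "(k * R)\<^sup>2 < R\<^sup>2" using k R by (intro power_strict_mono) auto
    moreover have "0 \<le> 2 * s * max 0 (x 0)" using s by simp
    ultimately show "x \<in> H" using Q_point[OF x] x by (simp add: H_def cap_union_def Q_def)
  qed
  have disj: "atom_cell d p R s \<inter> Q = {}"
  proof -
    have "x \<notin> atom_cell d p R s" if x: "x \<in> Q" for x
    proof -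
      have "(R\<^sup>2 + s\<^sup>2) powr (p/2) - R\<^sup>2 powr (p/2)
          \<le> (sq_norm d x + (s\<^sup>2 - 2 * s * x 0)) powr (p/2) - sq_norm d x powr (p/2)"
      \<comment> \<open>The margin of \<open>Q\<close> inside the ball gives \<open>z\<close>. As
        \<open>1 - p / 2 \<ge> 1/4\<close>, the step may shrink by the relative amount
        \<open>3 / (16 * d)\<close>, and the slab \<open>x 0 \<le> s / (16 * d)\<close> costs at
        most \<open>1 / (8 * d)\<close>.\<close>
      proof (rule powr_increment_le[where z="1 - 3 / (4 * real d)"])
        have "2 * s * x 0 \<le> 2 * s * (s / (16 * real d))" using Q_point[OF x] s by (intro mult_left_mono) auto
        also have "\<dots> = s\<^sup>2 * (1 / (8 * real d))" by (simp add: power2_eq_square)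
        finally have e: "(1 - 1 / (8 * real d)) * s\<^sup>2 \<le> s\<^sup>2 - 2 * s * x 0" by (simp add: algebra_simps)
        have "0 < (1 - 1 / (8 * real d)) * s\<^sup>2" using s rd by (intro mult_pos_pos) (auto simp: field_simps)
        with e show "0 < s\<^sup>2 - 2 * s * x 0" by linarith
        have "1/4 * (3 / (4 * real d)) \<le> (1 - p / 2) * (3 / (4 * real d))"
          using p by (intro mult_right_mono) auto
        moreover have "1 / (8 * real d) \<le> 1/4 * (3 / (4 * real d))" using rd by (simp add: field_simps)
        ultimately have "1 - (1 - p / 2) * (1 - (1 - 3 / (4 * real d))) \<le> 1 - 1 / (8 * real d)" by simp
        then have "(1 - (1 - p / 2) * (1 - (1 - 3 / (4 * real d)))) * s\<^sup>2 \<le> (1 - 1 / (8 * real d)) * s\<^sup>2"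
          by (rule mult_right_mono) simp
        with e show "(1 - (1 - p / 2) * (1 - (1 - 3 / (4 * real d)))) * s\<^sup>2 \<le> s\<^sup>2 - 2 * s * x 0" by linarith
        have "0 \<le> 2 * s * x 0" using Q_point[OF x] s by simp
        then have "sq_norm d x + (s\<^sup>2 - 2 * s * x 0) \<le> (k * R)\<^sup>2 + s\<^sup>2"
          using Q_point[OF x] by linarith
        also have "\<dots> = (1 - 1 / real d + 1 / (2 * (real d)\<^sup>2)) * R\<^sup>2"
          using d by (simp add: k_def s_def power2_eq_square field_simps)
        also have "\<dots> \<le> (1 - 3 / (4 * real d)) * R\<^sup>2"
        proof (rule mult_right_mono)
          have "1 / (2 * (real d)\<^sup>2) \<le> 1 / (4 * real d)" using rd by (simp add: field_simps power2_eq_square)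
          moreover have "1 / real d = 1 / (4 * real d) + 3 / (4 * real d)" using rd by (simp add: field_simps)
          ultimately show "1 - 1 / real d + 1 / (2 * (real d)\<^sup>2) \<le> 1 - 3 / (4 * real d)" by linarith
        qed simp
        finally show "sq_norm d x + (s\<^sup>2 - 2 * s * x 0) \<le> (1 - 3 / (4 * real d)) * R\<^sup>2" .
        show "0 < 1 - 3 / (4 * real d)" using rd by (simp add: field_simps)
      qed (use R p in \<open>auto simp: sq_norm_nonneg\<close>)
      then show ?thesis by (simp add: atom_cell_def algebra_simps)
    qed
    then show ?thesis by blast
  qed
  have fm: "A \<in> fmeasurable ?L" if "A \<subseteq> H" "A \<in> sets ?L" for A
  proof -
    have "emeasure ?L A \<le> emeasure ?L (cap_union d R s)"
      using that by (intro emeasure_mono) (auto simp: H_def)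
    then show ?thesis using that emeasure_cap_union_finite[OF d0, of s R] s by (auto simp: fmeasurable_def intro: le_less_trans)
  qed
  have "measure ?L (atom_cell d p R s) + measure ?L Q = measure ?L (atom_cell d p R s \<union> Q)"
    using disj fm[OF sub1 sets_atom_cell[OF d0]] fm[OF sub2 Q] by (intro measure_Union[symmetric]) (auto simp: fmeasurable_def)
  also have "\<dots> \<le> measure ?L H"
    using sub1 sub2 Q fm[OF order_refl H] by (intro measure_mono_fmeasurable) auto
  finally have *: "measure ?L (atom_cell d p R s) + measure ?L Q \<le> measure ?L H" .
  have "measure ?L B = (\<Prod>i<d. \<bar>c i\<bar>) * measure ?L Q"
    unfolding Q_def using l B by (intro measure_lborel_Rd_scale) (auto simp: c_def)
  also have "(\<Prod>i<d. \<bar>c i\<bar>) = l"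
  proof -
    have I: "{..<d} = insert 0 {1..<d}" using d by auto
    have "(\<Prod>i\<in>{1..<d}. \<bar>c i\<bar>) = 1" by (rule prod.neutral) (auto simp: c_def)
    then show ?thesis using l unfolding I by (simp add: c_def)
  qed
  finally have BQ: "measure ?L B = l * measure ?L Q" .
  have "1/2 \<le> k ^ d"
    using Bernoulli_inequality[of "- (1 / (2 * real d))" d] rd by (simp add: k_def field_simps)
  then have "1/2 * (1/3) \<le> k ^ d * measure ?L (cap_union d R 0)"
    using measure_ball_ge[OF d0 R vol] by (intro mult_mono) auto
  also have "\<dots> = measure ?L (cap_union d (k * R) 0)"
    using measure_cap_union_scale[of d k R 0] d0 k by simp
  also have "\<dots> \<le> 2 * measure ?L B" unfolding B_def by (rule half_cap_union[OF d0 order_refl])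
  finally have "1/12 \<le> l * measure ?L Q" using BQ by simp
  also have "\<dots> \<le> 32 * (real d)\<^sup>2 * measure ?L Q"
    unfolding l_def using k by (intro mult_right_mono mult_left_le) auto
  finally have "1 / (384 * (real d)\<^sup>2) \<le> measure ?L Q" using rd by (simp add: field_simps)
  with * show ?thesis unfolding H_def s_def by linarith
qed

section \<open>Choice of parameters and conclusion\<close>

lemma projection_expands:
  assumes d: "1 < d" and p: "1 < p" "p < 1 + 1 / (1000 * (real d)\<^sup>2 * ln (real d))"
  shows "\<exists>\<mu> \<in> P_space d p. \<exists>\<nu> \<in> P_space d p.
    wasserstein d p \<mu> \<nu> < wasserstein d p (projection d p \<mu>) (projection d p \<nu>)"
proof -
  have d0: "0 < d" and rd: "2 \<le> real d" using d by auto
  have "ln 2 \<le> ln (real d)" using rd by simp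
  \<comment> \<open>This turns the assumed bound on \<open>p - 1\<close> into
    \<open>1 / (500 * d\<^sup>2)\<close>, below the volume gain
    \<open>1 / (384 * d\<^sup>2)\<close>.\<close>
  then have ln: "1/2 \<le> ln (real d)" using ln2_ge_two_thirds by linarith
  have "p - 1 < 1 / (1000 * (real d)\<^sup>2 * ln (real d))" using p by simp
  also have "\<dots> \<le> 1 / (1000 * (real d)\<^sup>2 * (1/2))"
    using rd ln by (intro divide_left_mono mult_left_mono mult_pos_pos) auto
  also have "\<dots> < 1 / (384 * (real d)\<^sup>2)" using rd by (simp add: field_simps)
  finally have p_lt: "p - 1 < 1 / (384 * (real d)\<^sup>2)" .
  also have "\<dots> \<le> 1 / (384 * 2\<^sup>2)" using rd by (intro divide_left_mono mult_left_mono power_mono) auto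
  finally have p_le: "p \<le> 3/2" by simp
  obtain R where R: "0 < R" "measure (lborel_Rd d) (cap_union d R (1 / (2 * real d) * R)) = 1"
    by (rule ex_cap_union_volume_1[OF d, of "1 / (2 * real d)"]) auto
  obtain R' where R': "0 < R'" "measure (lborel_Rd d) (cap_union d R' 0) = 1"
    by (rule ex_cap_union_volume_1[OF d, of 0]) auto
  define s where "s = R / (2 * real d)"
  have s: "0 < s" and vol: "measure (lborel_Rd d) (cap_union d R s) = 1"
    using R d by (auto simp: s_def)
  define h where "h = measure (lborel_Rd d) {x \<in> cap_union d R s. 0 \<le> x 0}"
  have h_ge: "1/2 \<le> h" using half_cap_union[OF d0 less_imp_le[OF s], of R] vol by (simp add: h_def)
  have h_le: "h \<le> 1"
  proof -
    have "{x \<in> cap_union d R s. 0 \<le> x 0} = cap_union d R s \<inter> {x \<in> space (lborel_Rd d). 0 \<le> x 0}"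
      by (auto simp: cap_union_def)
    also have "\<dots> \<in> sets (lborel_Rd d)"
      using measurable_component_Rd[OF d0] sets_cap_union[OF d0] by measurable
    finally show ?thesis
      unfolding h_def vol[symmetric] using d0 s by (intro measure_mono_cap_union) auto
  qed
  have "measure (lborel_Rd d) (atom_cell d p R s) + 1 / (384 * (real d)\<^sup>2) \<le> h"
    unfolding h_def s_def using vol by (intro atom_cell_volume d p(1) p_le R(1)) (simp add: s_def)
  then have "measure (lborel_Rd d) (atom_cell d p R s) < h - (p - 1)" using p_lt by linarith
  also have "\<dots> \<le> h - h * (p - 1)"
  proof -
    have "h * (p - 1) \<le> 1 * (p - 1)" by (rule mult_right_mono[OF h_le]) (use p in simp)
    then show ?thesis unfolding mult_1 by (rule diff_left_mono)
  qed
  also have "\<dots> = h * (1 - (p - 1))" by (simp add: algebra_simps)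
  \<comment> \<open>Since \<open>h \<ge> 1/2\<close>, the power is at least
    \<open>exp (- (p - 1) * ln 2)\<close>, hence at least \<open>1 - (p - 1) * ln 2\<close>, and
    \<open>ln 2 < 1\<close>.\<close>
  also have "\<dots> \<le> h * h powr (p - 1)"
  proof (rule mult_left_mono)
    have "(p - 1) * ln 2 \<le> (p - 1) * 1" using p ln_2_less_1 by (intro mult_left_mono) auto
    then have "1 - (p - 1) \<le> 1 + - ((p - 1) * ln 2)" by simp
    also have "\<dots> \<le> exp (- ((p - 1) * ln 2))" by (rule exp_ge_add_one_self)
    also have "\<dots> = (1/2) powr (p - 1)" by (simp add: powr_def ln_div)
    also have "\<dots> \<le> h powr (p - 1)" using h_ge p by (intro powr_mono2) auto
    finally show "1 - (p - 1) \<le> h powr (p - 1)" .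
  qed (use h_ge in simp)
  also have "\<dots> = h powr p" using h_ge by (simp add: powr_mult_base)
  finally have lt: "measure (lborel_Rd d) (atom_cell d p R s) < h powr p" .
  have e: "emeasure (lborel_Rd d) (cap_union d R s) = 1" "emeasure (lborel_Rd d) (cap_union d R' 0) = 1"
    using emeasure_cap_union_eq_1[OF d0] s vol R' by auto
  show ?thesis
  proof (intro bexI)
    show "wasserstein d p (two_atoms d p R s) (two_atoms d p R' 0)
        < wasserstein d p (projection d p (two_atoms d p R s)) (projection d p (two_atoms d p R' 0))"
      using d0 p(1) s R(1) R'(1) vol R'(2) lt unfolding h_def by (rule wasserstein_lt_of_volumes)
    show "two_atoms d p R s \<in> P_space d p" "two_atoms d p R' 0 \<in> P_space d p"
      using two_atoms_P_space[OF d0] e s p by auto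
  qed
qed

theorem proposition3p5:
  "(\<forall>d::nat. d > 1 \<longrightarrow>
      (\<exists>p\<^sub>d::real. p\<^sub>d > 1 \<and>
        (\<forall>p::real. 1 < p \<and> p < p\<^sub>d \<longrightarrow>
          (\<exists>\<mu> \<in> P_space d p. \<exists>\<nu> \<in> P_space d p.
             wasserstein d p (projection d p \<mu>) (projection d p \<nu>) > wasserstein d p \<mu> \<nu>))))
   \<and>
   (\<exists>C::real. C > 0 \<and>
      (\<forall>d::nat. d > 1 \<longrightarrow>
        (\<forall>p::real. 1 < p \<and> p < 1 + 1 / (C * (real d)\<^sup>2 * ln (real d)) \<longrightarrow>
          (\<exists>\<mu> \<in> P_space d p. \<exists>\<nu> \<in> P_space d p.
             wasserstein d p (projection d p \<mu>) (projection d p \<nu>) > wasserstein d p \<mu> \<nu>))))"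
proof (intro conjI allI impI)
  fix d :: nat assume d: "1 < d"
  show "\<exists>p\<^sub>d::real. p\<^sub>d > 1 \<and> (\<forall>p::real. 1 < p \<and> p < p\<^sub>d \<longrightarrow>
      (\<exists>\<mu> \<in> P_space d p. \<exists>\<nu> \<in> P_space d p.
         wasserstein d p (projection d p \<mu>) (projection d p \<nu>) > wasserstein d p \<mu> \<nu>))"
    using d projection_expands[OF d]
    by (intro exI[of _ "1 + 1 / (1000 * (real d)\<^sup>2 * ln (real d))"]) auto
next
  show "\<exists>C::real. C > 0 \<and> (\<forall>d::nat. d > 1 \<longrightarrow>
      (\<forall>p::real. 1 < p \<and> p < 1 + 1 / (C * (real d)\<^sup>2 * ln (real d)) \<longrightarrow>
        (\<exists>\<mu> \<in> P_space d p. \<exists>\<nu> \<in> P_space d p.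
           wasserstein d p (projection d p \<mu>) (projection d p \<nu>) > wasserstein d p \<mu> \<nu>)))"
    using projection_expands by (intro exI[of _ 1000]) auto
qed

end
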